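(* Let $n$ and $d$ be positive integers with $n> 36(d+1)$, and let $\mathcal{F}\subset 2^{[n]}$ be a $(2d+1)$-union family. Then $$\sigma_{2d+1}(\mathcal{F})\leq 2\binom{n-3}{d-1}.$$
   Context: $[n]=\{1,2,\ldots,n\}$ and $2^{[n]}$ is its power set. For a positive integer $u$, a family $\mathcal{F}\subset 2^{[n]}$ is called $u$-union if $|F\cup F'|\leq u$ for all $F,F'\in\mathcal{F}$ (including $F=F'$). For $x\in[n]$ let $\mathcal{K}_x(n,2d+1)=\{K\subset [n]\colon |K\setminus \{x\}|\leq d\}$. The overflow of a family $\mathcal{F}\subset 2^{[n]}$ is $\sigma_{2d+1}(\mathcal{F})=\min_{x\in [n]}|\mathcal{F}\setminus \mathcal{K}_x(n,2d+1)|$. *)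

theory Defs
  imports Main
begin

(* Meant for families of finite sets: card is 0 on infinite sets. F = F' is included. *)
definition union_family :: "nat \<Rightarrow> 'a set set \<Rightarrow> bool" where
  "union_family u \<F> \<longleftrightarrow> (\<forall>F\<in>\<F>. \<forall>F'\<in>\<F>. card (F \<union> F') \<le> u)"

(* The family K_x(n, 2d+1); it is indexed here by d, not by 2d+1. *)
definition kfam :: "nat \<Rightarrow> nat \<Rightarrow> nat \<Rightarrow> nat set set" where
  "kfam n d x = {K. K \<subseteq> {1..n} \<and> card (K - {x}) \<le> d}"

(* The overflow sigma_{2d+1}; again indexed by d. Min is over a finite set, nonempty for n \<ge> 1. *)
definition overflow :: "nat \<Rightarrow> nat \<Rightarrow> nat set set \<Rightarrow> nat" where
  "overflow n d \<F> = Min ((\<lambda>x. card (\<F> - kfam n d x)) ` {1..n})"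

end

(* Write k = d + 1 and C = (n-3 choose d-1). The members of size at least k + 1 count in every
   F \ K_x, those of size k only if they avoid x. So it suffices to bound by C both the
   number of large members and the diversity (minimal number of members avoiding a vertex) of
   the intersecting k-uniform part.

   The engine is a dichotomy for cross-intersecting pairs (P, Q). Here U = (n-3 choose d-2), read as 0 for d = 1,
   is at most C/35. After shifting, if one family has more sets than there are
   lattice walks reaching a low level, then all walks of the other reach a high one, so the
   other is small, and a first-hitting-time induction gives |P| + r^c |Q| <= binomial.
   Applied to traces on two or three vertices it shows that three pairs x y, x z, y z of
   codegree above 3 U force diversity at most C.

   Such a triangle exists when the diversity exceeds C. First, a family of more than 35 U
   sets has a vertex of degree above 8 U. Otherwise shift as long as all degrees stay at
   most 8 U; a shift that lifts a vertex into (8 U, 16 U] is followed by shifts avoiding that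
   vertex, and a second such vertex is excluded because the two links would have a common
   centre, that is, a codegree above 3 U, whereas such a pair of vertices covers all but U sets.
   Second, starting from a vertex a of maximum degree, a heavy vertex b of the sets avoiding a,
   and the common centre c of the two resulting links, either a b c is a triangle or the
   sets avoiding c have another heavy vertex, whose common centre with c cannot exist. *)
theory Submission
  imports Defs
begin

section \<open>Shifting\<close>

abbreviation ksets :: "'a set \<Rightarrow> nat \<Rightarrow> 'a set set" where
  "ksets V b \<equiv> {X. X \<subseteq> V \<and> card X = b}"

text \<open>Taking \<open>P = Q\<close> gives the \<open>t\<close>-intersecting property, with each
  member also paired with itself.\<close>

definition cross :: "nat \<Rightarrow> 'a set set \<Rightarrow> 'a set set \<Rightarrow> bool" where
  "cross t P Q \<longleftrightarrow> (\<forall>X\<in>P. \<forall>Y\<in>Q. t \<le> card (X \<inter> Y))"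

text \<open>The classical compression exchanging \<open>j\<close> for \<open>i\<close>. It is
  blocked when the result is already present, so that no two members merge.\<close>

definition move :: "'a \<Rightarrow> 'a \<Rightarrow> 'a set set \<Rightarrow> 'a set \<Rightarrow> 'a set" where
  "move i j P X = (if j \<in> X \<and> i \<notin> X \<and> insert i (X - {j}) \<notin> P then insert i (X - {j}) else X)"

definition shift :: "'a \<Rightarrow> 'a \<Rightarrow> 'a set set \<Rightarrow> 'a set set" where
  "shift i j P = move i j P ` P"

text \<open>Only exchanges inside \<open>J\<close> are considered, so that a chosen vertex can be
  kept out of the shifting.\<close>

definition shifted :: "nat set \<Rightarrow> nat set set \<Rightarrow> bool" where
  "shifted J P \<longleftrightarrow> (\<forall>X\<in>P. \<forall>j\<in>X \<inter> J. \<forall>i\<in>J. i < j \<longrightarrow> i \<notin> X \<longrightarrow> insert i (X - {j}) \<in> P)"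

text \<open>A moved set lands outside \<open>P\<close>, so it cannot meet a set that stayed, and two
  moved sets with equal images agree once the exchange is undone.\<close>

lemma inj_on_move: "inj_on (move i j P) P"
proof (rule inj_onI)
  fix X Y assume "X \<in> P" "Y \<in> P" and eq: "move i j P X = move i j P Y"
  show "X = Y"
  proof (cases "j \<in> X \<and> i \<notin> X \<and> insert i (X - {j}) \<notin> P")
    case True
    then have "j \<in> Y \<and> i \<notin> Y \<and> insert i (Y - {j}) \<notin> P"
      using eq \<open>Y \<in> P\<close> by (auto simp: move_def split: if_splits)
    then have "insert i (X - {j}) = insert i (Y - {j})" using eq True by (simp add: move_def)
    then have "X - {j} = Y - {j}" using True \<open>j \<in> Y \<and> _\<close> by (simp add: insert_ident)
    then show ?thesis using True \<open>j \<in> Y \<and> _\<close> by blast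
  next
    case False
    then have "move i j P X = X" by (auto simp: move_def)
    then show ?thesis using eq \<open>X \<in> P\<close> by (auto simp: move_def split: if_splits)
  qed
qed

lemma card_shift: "card (shift i j P) = card P"
  unfolding shift_def by (rule card_image[OF inj_on_move])

lemma card_move:
  assumes "finite X" shows "card (move i j P X) = card X"
  using assms by (auto simp: move_def card_Diff_singleton card_gt_0_iff)
     (metis card_gt_0_iff Suc_pred empty_iff)

lemma shift_ksets:
  assumes "finite V" "i \<in> V" "P \<subseteq> ksets V b"
  shows "shift i j P \<subseteq> ksets V b"
proof
  fix Y assume "Y \<in> shift i j P"
  then obtain X where X: "X \<in> P" "Y = move i j P X" by (auto simp: shift_def)
  then have XV: "X \<subseteq> V" "card X = b" using assms(3) by auto
  then have "card Y = b" by (simp add: X(2) card_move[OF finite_subset[OF XV(1) assms(1)]] XV(2))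
  moreover have "Y \<subseteq> V" using X(2) XV assms(2) by (auto simp: move_def)
  ultimately show "Y \<in> {X. X \<subseteq> V \<and> card X = b}" by simp
qed

lemma shift_Pow:
  assumes "i \<in> V" "P \<subseteq> Pow V" shows "shift i j P \<subseteq> Pow V"
  using assms by (auto simp: shift_def move_def split: if_splits)

text \<open>The threshold may depend on both sizes, because shifting preserves sizes. This form is
  needed for the large members, whose sizes vary; for uniform families \<open>c\<close> is
  constant.\<close>

lemma cross_shift_sizes:
  assumes fin: "\<And>X. X \<in> P \<Longrightarrow> finite X" "\<And>Y. Y \<in> Q \<Longrightarrow> finite Y" and ij: "i \<noteq> j"
    and cr: "\<And>X Y. X \<in> P \<Longrightarrow> Y \<in> Q \<Longrightarrow> c (card X) (card Y) \<le> card (X \<inter> Y)"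
    and X: "X' \<in> shift i j P" and Y: "Y' \<in> shift i j Q"
  shows "c (card X') (card Y') \<le> card (X' \<inter> Y')"
proof -
  obtain X where X: "X \<in> P" "X' = move i j P X" using X by (auto simp: shift_def)
  obtain Y where Y: "Y \<in> Q" "Y' = move i j Q Y" using Y by (auto simp: shift_def)
  have fX: "finite X" "finite Y" using X Y fin by auto
  have sz: "card X' = card X" "card Y' = card Y" using X Y card_move fX by auto
  let ?mx = "j \<in> X \<and> i \<notin> X \<and> insert i (X - {j}) \<notin> P"
  let ?my = "j \<in> Y \<and> i \<notin> Y \<and> insert i (Y - {j}) \<notin> Q"
  have base: "c (card X) (card Y) \<le> card (X \<inter> Y)" using cr X Y by blast
  have swap: "card (insert i (Z - {j})) = card Z" if "j \<in> Z" "i \<notin> Z" "finite Z" for Z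
    using that by (simp add: card.insert_remove card_Diff_singleton) (metis Suc_pred card_gt_0_iff empty_iff)
  consider "?mx" "?my" | "\<not> ?mx" "\<not> ?my" | "?mx" "\<not> ?my" | "\<not> ?mx" "?my" by blast
  then have "c (card X) (card Y) \<le> card (X' \<inter> Y')"
  proof cases
    case 1
    then have "X' \<inter> Y' = insert i ((X \<inter> Y) - {j})" using X Y by (auto simp: move_def)
    moreover have "card (insert i ((X \<inter> Y) - {j})) = card (X \<inter> Y)" using 1 fX by (intro swap) auto
    ultimately show ?thesis using base by simp
  next
    case 2
    then have "X' = X" "Y' = Y" using X Y by (auto simp: move_def)
    then show ?thesis using base by simp
  next
    case 3
    then have X': "X' = insert i (X - {j})" and Y': "Y' = Y" using X Y by (auto simp: move_def)
    show ?thesis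
    proof (cases "i \<in> Y \<or> j \<notin> Y")
      case True
      show ?thesis
      proof (cases "i \<in> Y \<and> j \<in> Y")
        case True
        then have "X' \<inter> Y' = insert i ((X \<inter> Y) - {j})" using X' Y' 3 by auto
        moreover have "card (insert i ((X \<inter> Y) - {j})) = card (X \<inter> Y)" using 3 True fX by (intro swap) auto
        ultimately show ?thesis using base by simp
      next
        case False
        then have "X \<inter> Y \<subseteq> X' \<inter> Y'" using True X' Y' 3 by auto
        then show ?thesis using base fX X' Y' by (meson card_mono finite_Diff finite_Int finite_insert le_trans)
      qed
    next
      case False
      \<comment> \<open>Here \<open>Y\<close> would have moved but was blocked, so its exchanged
        copy lies in \<open>Q\<close>. That copy meets \<open>X\<close> in exactly the set in which
        \<open>Y\<close> meets \<open>X'\<close>.\<close>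
      then have in_Q: "insert i (Y - {j}) \<in> Q" using 3 by blast
      have "X' \<inter> Y' = X \<inter> insert i (Y - {j})" using X' Y' 3 False by auto
      moreover have "card (insert i (Y - {j})) = card Y" using False fX by (intro swap) auto
      ultimately show ?thesis using cr[OF X(1) in_Q] by simp
    qed
  next
    case 4
    then have X': "Y' = insert i (Y - {j})" and Y': "X' = X" using X Y by (auto simp: move_def)
    show ?thesis
    proof (cases "i \<in> X \<or> j \<notin> X")
      case True
      show ?thesis
      proof (cases "i \<in> X \<and> j \<in> X")
        case True
        then have "X' \<inter> Y' = insert i ((X \<inter> Y) - {j})" using X' Y' 4 by auto
        moreover have "card (insert i ((X \<inter> Y) - {j})) = card (X \<inter> Y)" using 4 True fX by (intro swap) auto
        ultimately show ?thesis using base by simp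
      next
        case False
        then have "X \<inter> Y \<subseteq> X' \<inter> Y'" using True X' Y' 4 by auto
        then show ?thesis using base fX X' Y' by (meson card_mono finite_Diff finite_Int finite_insert le_trans)
      qed
    next
      case False
      then have in_P: "insert i (X - {j}) \<in> P" using 4 by blast
      have "X' \<inter> Y' = insert i (X - {j}) \<inter> Y" using X' Y' 4 False by auto
      moreover have "card (insert i (X - {j})) = card X" using False fX by (intro swap) auto
      ultimately show ?thesis using cr[OF in_P Y(1)] by simp
    qed
  qed
  then show ?thesis using sz by simp
qed

lemma cross_shift:
  assumes "\<And>X. X \<in> P \<Longrightarrow> finite X" "\<And>Y. Y \<in> Q \<Longrightarrow> finite Y" "i \<noteq> j" "cross t P Q"
  shows "cross t (shift i j P) (shift i j Q)"
  using cross_shift_sizes[of P Q i j "\<lambda>_ _. t"] assms unfolding cross_def by blast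

section \<open>Degrees under shifting: only the target vertex can gain, and at most the degree of
  the source\<close>

lemma degree_shift_other:
  assumes "l \<noteq> i" "l \<noteq> j"
  shows "card {X \<in> shift i j P. l \<in> X} = card {X \<in> P. l \<in> X}"
proof -
  have "{X \<in> shift i j P. l \<in> X} = move i j P ` {X \<in> P. l \<in> X}"
    using assms by (auto simp: shift_def move_def)
  then show ?thesis by (simp add: card_image inj_on_subset[OF inj_on_move])
qed

lemma degree_shift_source:
  assumes "finite P" "i \<noteq> j"
  shows "card {X \<in> shift i j P. j \<in> X} \<le> card {X \<in> P. j \<in> X}"
proof -
  have "{X \<in> shift i j P. j \<in> X} \<subseteq> move i j P ` {X \<in> P. j \<in> X}"
    using assms by (auto simp: shift_def move_def)
  then have "card {X \<in> shift i j P. j \<in> X} \<le> card (move i j P ` {X \<in> P. j \<in> X})"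
    using assms by (intro card_mono) auto
  also have "\<dots> \<le> card {X \<in> P. j \<in> X}" using assms by (intro card_image_le) auto
  finally show ?thesis .
qed

lemma degree_shift_target:
  assumes "finite P"
  shows "card {X \<in> shift i j P. i \<in> X} \<le> card {X \<in> P. i \<in> X} + card {X \<in> P. j \<in> X}"
proof -
  have "{X \<in> shift i j P. i \<in> X} \<subseteq> move i j P ` ({X \<in> P. i \<in> X} \<union> {X \<in> P. j \<in> X})"
    by (auto simp: shift_def move_def)
  then have "card {X \<in> shift i j P. i \<in> X}
      \<le> card (move i j P ` ({X \<in> P. i \<in> X} \<union> {X \<in> P. j \<in> X}))"
    using assms by (intro card_mono) auto
  also have "\<dots> \<le> card ({X \<in> P. i \<in> X} \<union> {X \<in> P. j \<in> X})"
    using assms by (intro card_image_le) auto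
  also have "\<dots> \<le> card {X \<in> P. i \<in> X} + card {X \<in> P. j \<in> X}" by (rule card_Un_le)
  finally show ?thesis .
qed

section \<open>Termination of repeated shifting\<close>

lemma sum_move_le:
  fixes X :: "nat set"
  assumes "finite X" "i < j" shows "\<Sum>(move i j P X) \<le> \<Sum>X"
    and "move i j P X \<noteq> X \<Longrightarrow> \<Sum>(move i j P X) < \<Sum>X"
proof -
  have *: "\<Sum>(insert i (X - {j})) < \<Sum>X" if "j \<in> X" "i \<notin> X"
    using that assms by (simp add: sum.remove[of X j] )
  show "\<Sum>(move i j P X) \<le> \<Sum>X" using * by (auto simp: move_def intro: less_imp_le)
  show "\<Sum>(move i j P X) < \<Sum>X" if "move i j P X \<noteq> X" using * that by (auto simp: move_def split: if_splits)
qed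

definition weight :: "nat set set \<Rightarrow> nat" where "weight P = (\<Sum>X\<in>P. \<Sum>X)"

lemma weight_shift:
  assumes "finite V" "P \<subseteq> Pow V" "i < j"
  shows "weight (shift i j P) \<le> weight P"
    and "X \<in> P \<Longrightarrow> move i j P X \<noteq> X \<Longrightarrow> weight (shift i j P) < weight P"
proof -
  have fin: "finite X" if "X \<in> P" for X using that assms finite_subset by blast
  have finP: "finite P" using assms by (meson finite_Pow_iff finite_subset)
  have eq: "weight (shift i j P) = (\<Sum>X\<in>P. \<Sum>(move i j P X))"
    unfolding weight_def shift_def by (simp add: sum.reindex[OF inj_on_move])
  have "(\<Sum>X\<in>P. \<Sum>(move i j P X)) \<le> (\<Sum>X\<in>P. \<Sum>X)"
    using fin assms by (intro sum_mono sum_move_le) auto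
  then show "weight (shift i j P) \<le> weight P" using eq weight_def[of P] by linarith
  have "(\<Sum>X\<in>P. \<Sum>(move i j P X)) < (\<Sum>X\<in>P. \<Sum>X)" if "X \<in> P" "move i j P X \<noteq> X"
  proof (rule sum_strict_mono_ex1[OF finP])
    show "\<forall>X\<in>P. \<Sum>(move i j P X) \<le> \<Sum>X" using fin assms(3) sum_move_le(1) by blast
    show "\<exists>X\<in>P. \<Sum>(move i j P X) < \<Sum>X"
      using sum_move_le(2)[OF fin[OF that(1)] assms(3) that(2)] that(1) by blast
  qed
  then show "weight (shift i j P) < weight P" if "X \<in> P" "move i j P X \<noteq> X"
    using that eq weight_def[of P] by linarith
qed

text \<open>While some exchange inside \<open>J\<close> is possible, performing it lowers the total
  weight and keeps the invariant \<open>I\<close>, so the process stops. Both families undergo the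
  same shifts; a single family is shifted by pairing it with \<open>{}\<close>.\<close>

lemma shift_to_shifted:
  assumes V: "finite V" "J \<subseteq> V" and "P \<subseteq> Pow V" "Q \<subseteq> Pow V" "I P Q"
    and step: "\<And>P Q i j. I P Q \<Longrightarrow> P \<subseteq> Pow V \<Longrightarrow> Q \<subseteq> Pow V \<Longrightarrow> i \<in> J \<Longrightarrow> j \<in> J \<Longrightarrow> i < j
      \<Longrightarrow> I (shift i j P) (shift i j Q)"
  shows "\<exists>P' Q'. P' \<subseteq> Pow V \<and> Q' \<subseteq> Pow V \<and> I P' Q' \<and> shifted J P' \<and> shifted J Q'"
  using assms(3-5)
proof (induction "weight P + weight Q" arbitrary: P Q rule: less_induct)
  case less
  show ?case
  proof (cases "shifted J P \<and> shifted J Q")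
    case True then show ?thesis using less.prems by blast
  next
    case False
    have "\<exists>X\<in>R. \<exists>j\<in>X \<inter> J. \<exists>i\<in>J. i < j \<and> i \<notin> X \<and> insert i (X - {j}) \<notin> R"
      if "\<not> shifted J R" for R using that unfolding shifted_def by blast
    with False obtain X i j
      where X: "X \<in> P \<and> insert i (X - {j}) \<notin> P \<or> X \<in> Q \<and> insert i (X - {j}) \<notin> Q"
      "j \<in> X" "j \<in> J" "i \<in> J" "i < j" "i \<notin> X"
      by (metis IntE)
    have ne: "insert i (X - {j}) \<noteq> X" using X by auto
    have "weight (shift i j P) + weight (shift i j Q) < weight P + weight Q"
      using X(1)
    proof
      assume a: "X \<in> P \<and> insert i (X - {j}) \<notin> P"
      then have "move i j P X \<noteq> X" using X ne by (simp add: move_def)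
      then have "weight (shift i j P) < weight P"
        using weight_shift(2)[OF V(1) less.prems(1) \<open>i < j\<close>] a by blast
      then show ?thesis using weight_shift(1)[OF V(1) less.prems(2) \<open>i < j\<close>] by linarith
    next
      assume a: "X \<in> Q \<and> insert i (X - {j}) \<notin> Q"
      then have "move i j Q X \<noteq> X" using X ne by (simp add: move_def)
      then have "weight (shift i j Q) < weight Q"
        using weight_shift(2)[OF V(1) less.prems(2) \<open>i < j\<close>] a by blast
      then show ?thesis using weight_shift(1)[OF V(1) less.prems(1) \<open>i < j\<close>] by linarith
    qed
    moreover have "shift i j P \<subseteq> Pow V" "shift i j Q \<subseteq> Pow V"
      using shift_Pow[OF subsetD[OF V(2) \<open>i \<in> J\<close>]] less.prems by simp_all
    moreover have "I (shift i j P) (shift i j Q)" using less.prems X by (intro step) simp_all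
    ultimately show ?thesis by (rule less.hyps)
  qed
qed

section \<open>Hitting numbers of shifted families\<close>

text \<open>The number of \<open>b\<close>-subsets of an \<open>m\<close>-set whose walk gets \<open>h\<close> above the diagonal is at most
  \<open>m choose (b - h)\<close> by reflection; the case distinction replaces truncated subtraction.\<close>

definition chm :: "nat \<Rightarrow> nat \<Rightarrow> nat \<Rightarrow> nat" where
  "chm m b h = (if h \<le> b then m choose (b - h) else 0)"

text \<open>Reading \<open>V\<close> in increasing order with a step up at elements of \<open>X\<close> and a step down elsewhere,
  the walk of \<open>X\<close> reaches height \<open>a\<close>.\<close>

definition hits :: "nat set \<Rightarrow> nat set \<Rightarrow> nat \<Rightarrow> bool" where
  "hits V X a \<longleftrightarrow> (\<exists>j. card (V \<inter> {..<j}) + a \<le> 2 * card (X \<inter> {..<j}))"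

lemma hits_0 [simp]: "hits V X 0"
  unfolding hits_def by (rule exI[of _ 0]) simp

lemma hits_le_card:
  assumes "hits V X a" "X \<subseteq> V" "finite V" shows "a \<le> card X"
proof -
  obtain j where j: "card (V \<inter> {..<j}) + a \<le> 2 * card (X \<inter> {..<j})"
    using assms(1) by (auto simp: hits_def)
  have "card (X \<inter> {..<j}) \<le> card (V \<inter> {..<j})" using assms by (intro card_mono) auto
  moreover have "card (X \<inter> {..<j}) \<le> card X" using assms finite_subset by (intro card_mono) auto
  ultimately show ?thesis using j by linarith
qed

lemma card_first_step:
  fixes V :: "nat set"
  assumes "finite V" "v \<in> V" "v < j"
  shows "card (V \<inter> {..<j}) = Suc (card ((V - {v}) \<inter> {..<j}))"
proof -
  have "V \<inter> {..<j} = insert v ((V - {v}) \<inter> {..<j})" using assms by auto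
  then show ?thesis using assms by simp
qed

text \<open>Before the first element of \<open>V\<close> the walk is at height 0, so a positive
  height is reached only beyond it.\<close>

lemma hits_positive_index:
  assumes "hits V X a" "0 < a" "X \<subseteq> V" "\<And>w. w \<in> V \<Longrightarrow> v \<le> w"
  obtains j where "v < j" "card (V \<inter> {..<j}) + a \<le> 2 * card (X \<inter> {..<j})"
proof -
  obtain j where j: "card (V \<inter> {..<j}) + a \<le> 2 * card (X \<inter> {..<j})"
    using assms(1) by (auto simp: hits_def)
  have "v < j"
  proof (rule ccontr)
    assume "\<not> v < j"
    then have "X \<inter> {..<j} = {}" using assms(3,4) by fastforce
    then show False using j assms(2) by simp
  qed
  then show ?thesis using j that by blast
qed

text \<open>The walk starts with an up-step, so the remaining walk has one level less to
  gain.\<close>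

lemma hits_Min_in:
  assumes "finite V" "X \<subseteq> V" "v \<in> X" "\<And>w. w \<in> V \<Longrightarrow> v \<le> w" "hits V X (Suc a)"
  shows "hits (V - {v}) (X - {v}) a"
proof -
  obtain j where j: "v < j" "card (V \<inter> {..<j}) + Suc a \<le> 2 * card (X \<inter> {..<j})"
    using hits_positive_index[OF assms(5) _ assms(2,4)] by auto
  have "finite X" using assms finite_subset by blast
  then show ?thesis using j card_first_step[OF assms(1), of v j] card_first_step[of X v j] assms(2,3)
    unfolding hits_def by (intro exI[of _ j]) auto
qed

text \<open>The walk starts with a down-step, which the remaining walk has to make up for. The
  condition \<open>0 < a\<close> rules out the trivial hit at the start.\<close>

lemma hits_Min_notin:
  assumes "finite V" "X \<subseteq> V" "v \<in> V" "v \<notin> X" "\<And>w. w \<in> V \<Longrightarrow> v \<le> w" "hits V X a" "0 < a"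
  shows "hits (V - {v}) X (Suc a)"
proof -
  obtain j where j: "v < j" "card (V \<inter> {..<j}) + a \<le> 2 * card (X \<inter> {..<j})"
    using hits_positive_index[OF assms(6,7,2,5)] by auto
  then show ?thesis using card_first_step[OF assms(1,3), of j]
    unfolding hits_def by (intro exI[of _ j]) auto
qed

text \<open>Pascal's rule: the three lower indices are \<open>b - a\<close>,
  \<open>b - a - 1\<close> and \<open>b - a\<close>.\<close>

lemma chm_step: "chm m b a + chm m (Suc b) (Suc (Suc a)) \<le> chm (Suc m) (Suc b) (Suc a)"
  by (cases "Suc a \<le> b") (auto simp: chm_def Suc_diff_le diff_Suc split: nat.splits)

text \<open>Splitting by the first step of the walk gives the recursion of \<open>chm_step\<close>:
  sets containing the minimum must then reach \<open>a - 1\<close>, the others \<open>a + 1\<close>.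
  This replaces the reflection argument.\<close>

lemma card_hits_le:
  assumes "finite V"
  shows "card {X. X \<subseteq> V \<and> card X = b \<and> hits V X a} \<le> chm (card V) b a"
  using assms
proof (induction "card V" arbitrary: V b a)
  case 0
  then have V: "V = {}" by simp
  show ?case
  proof (cases a)
    case (Suc a')
    then have "{X. X \<subseteq> V \<and> card X = b \<and> hits V X a} = {}" using V by (auto simp: hits_def)
    then show ?thesis by (metis card.empty zero_le)
  next
    case a0: 0
    have "{X. X \<subseteq> V \<and> card X = b \<and> hits V X a} = {X. X \<subseteq> V \<and> card X = b}" using a0 by simp
    then show ?thesis using n_subsets[of V b] a0 0 by (simp add: chm_def)
  qed
next
  case (Suc m)
  show ?case
  proof (cases a)
    case a0: 0
    have "{X. X \<subseteq> V \<and> card X = b \<and> hits V X a} = {X. X \<subseteq> V \<and> card X = b}" using a0 by simp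
    then show ?thesis using n_subsets[of V b] a0 Suc.prems by (simp add: chm_def)
  next
    case a: (Suc a')
    define v where "v = Min V"
    have "V \<noteq> {}" using Suc.hyps(2) by auto
    then have v: "v \<in> V" "\<And>w. w \<in> V \<Longrightarrow> v \<le> w" using Suc.prems by (auto simp: v_def)
    define W where "W = V - {v}"
    have W: "finite W" "card W = m" using Suc v by (auto simp: W_def)
    show ?thesis
    proof (cases b)
      case 0
      have "{X. X \<subseteq> V \<and> card X = b \<and> hits V X a} = {}"
        using hits_le_card[OF _ _ Suc.prems] a 0 by fastforce
      then show ?thesis by (metis card.empty zero_le)
    next
      case b: (Suc b')
      have "{X. X \<subseteq> V \<and> card X = b \<and> hits V X a} \<subseteq>
          insert v ` {X. X \<subseteq> W \<and> card X = b' \<and> hits W X a'} \<union> {X. X \<subseteq> W \<and> card X = b \<and> hits W X (Suc a)}"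
      proof
        fix X assume "X \<in> {X. X \<subseteq> V \<and> card X = b \<and> hits V X a}"
        then have X: "X \<subseteq> V" "card X = b" "hits V X a" by auto
        have fX: "finite X" using X Suc.prems finite_subset by blast
        show "X \<in> insert v ` {X. X \<subseteq> W \<and> card X = b' \<and> hits W X a'} \<union> {X. X \<subseteq> W \<and> card X = b \<and> hits W X (Suc a)}"
        proof (cases "v \<in> X")
          case True
          then have "hits W (X - {v}) a'" using hits_Min_in[OF Suc.prems X(1) True v(2)] X a W_def by simp
          moreover have "X = insert v (X - {v})" using True by auto
          moreover have "card (X - {v}) = b'" using True X b fX by simp
          ultimately show ?thesis using X(1) W_def by blast
        next
          case False
          then show ?thesis using hits_Min_notin[OF Suc.prems X(1) v(1) False v(2)] X a W_def by auto
        qed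
      qed
      then have "card {X. X \<subseteq> V \<and> card X = b \<and> hits V X a} \<le>
          card (insert v ` {X. X \<subseteq> W \<and> card X = b' \<and> hits W X a'} \<union> {X. X \<subseteq> W \<and> card X = b \<and> hits W X (Suc a)})"
        using W by (intro card_mono) auto
      also have "\<dots> \<le> card {X. X \<subseteq> W \<and> card X = b' \<and> hits W X a'} + card {X. X \<subseteq> W \<and> card X = b \<and> hits W X (Suc a)}"
        using W by (intro order.trans[OF card_Un_le] add_mono card_image_le) auto
      also have "\<dots> \<le> chm m b' a' + chm m b (Suc a)"
        using Suc.hyps(1)[OF W(2)[symmetric] W(1)] W(2) by (intro add_mono) auto
      also have "\<dots> \<le> chm (card V) b a" using chm_step a b Suc.hyps(2) by metis
      finally show ?thesis .
    qed
  qed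
qed

text \<open>Frankl's prefix criterion, by induction on the size of \<open>X \<inter> Y\<close>. If
  every prefix fails, some \<open>z\<close> before the \<open>t\<close>-th common element
  \<open>s\<close> lies in neither set; exchanging \<open>s\<close> for \<open>z\<close> in
  \<open>Y\<close> makes the intersection smaller, and the prefix found for the new pair also leads
  to a contradiction.\<close>

lemma shifted_cross_prefix:
  assumes V: "finite V" "P \<subseteq> Pow V" "Q \<subseteq> Pow V" and sh: "shifted V Q" and cr: "cross t P Q"
    and t: "0 < t" and X: "X \<in> P" and "Y \<in> Q"
  shows "\<exists>j. card (V \<inter> {..<j}) + t \<le> card (X \<inter> {..<j}) + card (Y \<inter> {..<j})"
  using \<open>Y \<in> Q\<close>
proof (induction "card (X \<inter> Y)" arbitrary: Y rule: less_induct)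
  case less
  show ?case
  proof (rule ccontr)
    assume none: "\<not> ?thesis"
    have XV: "X \<subseteq> V" "Y \<subseteq> V" using V X less.prems by auto
    then have fin: "finite X" "finite Y" using V(1) finite_subset by auto
    have un_int: "card (X \<inter> {..<j}) + card (Y \<inter> {..<j})
        = card ((X \<union> Y) \<inter> {..<j}) + card (X \<inter> Y \<inter> {..<j})" for j
    proof -
      have "(X \<inter> {..<j}) \<union> (Y \<inter> {..<j}) = (X \<union> Y) \<inter> {..<j}"
        "(X \<inter> {..<j}) \<inter> (Y \<inter> {..<j}) = X \<inter> Y \<inter> {..<j}" by auto
      then show ?thesis using card_Un_Int[of "X \<inter> {..<j}" "Y \<inter> {..<j}"] fin by simp
    qed
    have "t \<le> card (X \<inter> Y)" using cr X less.prems by (auto simp: cross_def)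
    moreover obtain N where "X \<inter> Y \<subseteq> {..<N}" using fin
      by (meson finite_Int finite_nat_set_iff_bounded lessThan_iff subsetI)
    ultimately have ex: "t \<le> card (X \<inter> Y \<inter> {..<N})" by (simp add: Int_absorb2)
    \<comment> \<open>Just beyond the \<open>t\<close>-th common element: \<open>s = r - 1\<close>
      is that element.\<close>
    define r where "r = (LEAST N. t \<le> card (X \<inter> Y \<inter> {..<N}))"
    have r: "t \<le> card (X \<inter> Y \<inter> {..<r})" using ex unfolding r_def by (rule LeastI)
    then obtain s where s: "r = Suc s" using t by (cases r) auto
    have lt: "card (X \<inter> Y \<inter> {..<s}) < t"
      using not_less_Least[of s "\<lambda>N. t \<le> card (X \<inter> Y \<inter> {..<N})"] s r_def by simp
    have "s \<in> X \<inter> Y"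
    proof (rule ccontr)
      assume "s \<notin> X \<inter> Y"
      then have "X \<inter> Y \<inter> {..<r} = X \<inter> Y \<inter> {..<s}" using s by (auto simp: less_Suc_eq)
      then show False using r lt by simp
    qed
    then have sXY: "s \<in> X" "s \<in> Y" by auto
    have "card (X \<inter> {..<r}) + card (Y \<inter> {..<r}) < card (V \<inter> {..<r}) + t"
      using none by (meson not_le)
    then have "card ((X \<union> Y) \<inter> {..<r}) < card (V \<inter> {..<r})" using un_int[of r] r by linarith
    then have "\<not> V \<inter> {..<r} \<subseteq> (X \<union> Y) \<inter> {..<r}"
      by (metis card_mono fin finite_Int finite_Un not_less)
    then obtain z where z: "z \<in> V" "z < r" "z \<notin> X" "z \<notin> Y" by auto
    then have zs: "z < s" using s sXY by (metis less_Suc_eq)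
    define Y' where "Y' = insert z (Y - {s})"
    have Y'Q: "Y' \<in> Q" using sh less.prems sXY XV z zs unfolding shifted_def Y'_def by blast
    have "X \<inter> Y' = (X \<inter> Y) - {s}" using z by (auto simp: Y'_def)
    then have "card (X \<inter> Y') < card (X \<inter> Y)" using sXY fin by (simp add: card_Diff1_less del: card_Diff_insert)
    from less.hyps[OF this Y'Q] obtain j
      where j: "card (V \<inter> {..<j}) + t \<le> card (X \<inter> {..<j}) + card (Y' \<inter> {..<j})" by blast
    consider "j \<le> z" | "s < j" | "z < j" "j \<le> s" by linarith
    then show False
    proof cases
      case 1
      then have "Y' \<inter> {..<j} = Y \<inter> {..<j}" using zs by (auto simp: Y'_def)
      then show ?thesis using none j by auto
    next
      case 2
      then have "Y' \<inter> {..<j} = insert z ((Y \<inter> {..<j}) - {s})" using zs by (auto simp: Y'_def)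
      moreover have "card (insert z ((Y \<inter> {..<j}) - {s})) = card (Y \<inter> {..<j})"
        using sXY z 2 fin card_Suc_Diff1[of "Y \<inter> {..<j}" s] by simp
      ultimately show ?thesis using none j by auto
    next
      case 3
      then have "Y' \<inter> {..<j} = insert z (Y \<inter> {..<j})" using zs by (auto simp: Y'_def)
      then have cY: "card (Y' \<inter> {..<j}) = Suc (card (Y \<inter> {..<j}))" using z fin by simp
      \<comment> \<open>Between \<open>z\<close> and \<open>s\<close> the new set has one element
        more in the prefix than \<open>Y\<close>. But the prefix has at most \<open>t - 1\<close>
        common elements and the union misses \<open>z\<close>, so the sum still falls one
        short.\<close>
      have "card (X \<inter> Y \<inter> {..<j}) \<le> card (X \<inter> Y \<inter> {..<s})" using 3 fin by (intro card_mono) auto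
      moreover have "card ((X \<union> Y) \<inter> {..<j}) < card (V \<inter> {..<j})"
        using XV z 3 V by (intro psubset_card_mono) auto
      ultimately show ?thesis using j cY un_int[of j] lt by linarith
    qed
  qed
qed

text \<open>Double the prefix inequality and subtract the bound for \<open>X\<close>: below level
  \<open>b\<close> means at most \<open>b - 1\<close>, which explains the extra 1 in
  \<open>a + b = 2 t + 1\<close>.\<close>

lemma shifted_cross_hits:
  assumes "finite V" "P \<subseteq> Pow V" "Q \<subseteq> Pow V" "shifted V Q" "cross t P Q" "0 < t" "X \<in> P" "Y \<in> Q"
    and "\<not> hits V X b" "a + b = Suc (2 * t)"
  shows "hits V Y a"
proof -
  obtain j where "card (V \<inter> {..<j}) + t \<le> card (X \<inter> {..<j}) + card (Y \<inter> {..<j})"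
    using shifted_cross_prefix[OF assms(1-8)] by blast
  moreover have "2 * card (X \<inter> {..<j}) < card (V \<inter> {..<j}) + b"
    using assms(9) by (auto simp: hits_def not_le)
  ultimately have "card (V \<inter> {..<j}) + a \<le> 2 * card (Y \<inter> {..<j})" using assms(10) by linarith
  then show ?thesis by (auto simp: hits_def)
qed

section \<open>Size bounds for cross-intersecting pairs\<close>

text \<open>Only members meeting \<open>D\<close> in exactly \<open>S\<close> contribute, so
  \<open>D\<close> can be deleted injectively; \<open>S = D\<close> gives a link and
  \<open>S = {}\<close> the members avoiding \<open>D\<close>.\<close>

definition trace :: "'a set \<Rightarrow> 'a set \<Rightarrow> 'a set set \<Rightarrow> 'a set set" where
  "trace D S P = (\<lambda>X. X - D) ` {X \<in> P. X \<inter> D = S}"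

lemma finite_ksets: "finite V \<Longrightarrow> finite (ksets V b)"
  by (rule finite_subset[of _ "Pow V"]) auto

lemma finite_family: "finite V \<Longrightarrow> P \<subseteq> ksets V b \<Longrightarrow> finite P"
  using finite_ksets finite_subset by blast

lemma card_family_le: "finite V \<Longrightarrow> P \<subseteq> ksets V b \<Longrightarrow> card P \<le> card V choose b"
  using n_subsets[of V b] card_mono[OF finite_ksets, of V P b] by simp

lemma card_trace: "card (trace D S P) = card {X \<in> P. X \<inter> D = S}"
  unfolding trace_def
proof (rule card_image, rule inj_onI)
  fix X Y assume "X \<in> {X \<in> P. X \<inter> D = S}" "Y \<in> {X \<in> P. X \<inter> D = S}" "X - D = Y - D"
  then show "X = Y" by (metis (mono_tags, lifting) Int_Diff_Un mem_Collect_eq)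
qed

lemma trace_subset:
  assumes "finite V" "P \<subseteq> Pow V" "X \<in> trace D S P"
  shows "X \<subseteq> V - D" "\<exists>Y\<in>P. card Y = card X + card S \<and> X = Y - D \<and> Y \<inter> D = S"
proof -
  obtain Y where Y: "Y \<in> P" "Y \<inter> D = S" "X = Y - D" using assms(3) by (auto simp: trace_def)
  show "X \<subseteq> V - D" using Y assms by auto
  have "finite Y" using Y assms finite_subset by blast
  then have "card Y = card X + card S" using Y
    by (metis Int_Diff_Un Int_Diff_disjoint add.commute card_Un_disjoint finite_Diff finite_Int)
  then show "\<exists>Y\<in>P. card Y = card X + card S \<and> X = Y - D \<and> Y \<inter> D = S" using Y by blast
qed

lemma trace_ksets:
  assumes "finite V" "P \<subseteq> ksets V b" "b = b' + card S"
  shows "trace D S P \<subseteq> ksets (V - D) b'"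
proof
  fix X assume X: "X \<in> trace D S P"
  have "P \<subseteq> Pow V" using assms by auto
  from trace_subset[OF assms(1) this X] assms show "X \<in> ksets (V - D) b'" by auto
qed

text \<open>Inside \<open>D\<close> two members share exactly \<open>S \<inter> S'\<close>; the rest
  of the intersection survives in the traces.\<close>

lemma cross_trace:
  assumes "finite V" "P \<subseteq> Pow V" "Q \<subseteq> Pow V" "cross t P Q" "t = t' + card (S \<inter> S')"
  shows "cross t' (trace D S P) (trace D S' Q)"
  unfolding cross_def
proof (intro ballI)
  fix X Y assume "X \<in> trace D S P" "Y \<in> trace D S' Q"
  then obtain A B where A: "A \<in> P" "A \<inter> D = S" "X = A - D" and B: "B \<in> Q" "B \<inter> D = S'" "Y = B - D"
    by (auto simp: trace_def)
  have "finite A" using A assms finite_subset by blast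
  have "A \<inter> B = (X \<inter> Y) \<union> (S \<inter> S')" "(X \<inter> Y) \<inter> (S \<inter> S') = {}" using A B by auto
  then have "card (A \<inter> B) = card (X \<inter> Y) + card (S \<inter> S')"
    using \<open>finite A\<close> A by (metis card_Un_disjoint finite_Diff finite_Int)
  moreover have "t \<le> card (A \<inter> B)" using A B assms(4) by (auto simp: cross_def)
  ultimately show "t' \<le> card (X \<inter> Y)" using assms(5) by simp
qed

lemma card_superset_le:
  assumes "finite V" "P \<subseteq> ksets V b" "D \<subseteq> V"
  shows "card {X \<in> P. D \<subseteq> X} \<le> chm (card V - card D) b (card D)"
proof -
  have eq: "{X \<in> P. D \<subseteq> X} = {X \<in> P. X \<inter> D = D}" by blast
  have fD: "finite D" using assms finite_subset by blast
  show ?thesis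
  proof (cases "card D \<le> b")
    case True
    then have "trace D D P \<subseteq> ksets (V - D) (b - card D)" using assms by (intro trace_ksets) auto
    then have "card (trace D D P) \<le> card (V - D) choose (b - card D)"
      using assms by (intro card_family_le) auto
    then show ?thesis using True fD assms unfolding eq card_trace by (simp add: chm_def card_Diff_subset)
  next
    case False
    have "{X \<in> P. D \<subseteq> X} = {}"
    proof -
      have "card D \<le> b" if "X \<in> P" "D \<subseteq> X" for X
        using that assms card_mono[of X D] finite_subset[of X V] by auto
      then show ?thesis using False by blast
    qed
    then show ?thesis by (metis card.empty zero_le)
  qed
qed

section \<open>Ratios of binomial coefficients and normalized matching\<close>

lemma binomial_ratio:
  assumes "Suc r * Suc j \<le> m" shows "r * (m choose j) \<le> m choose Suc j"
proof -
  have "Suc j * (m choose Suc j) = (m - j) * (m choose j)"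
    using binomial_absorption[of j m] binomial_absorb_comp[of m j] by simp
  moreover have "Suc j * r \<le> m - j" using assms by (simp add: algebra_simps)
  ultimately have "Suc j * (r * (m choose j)) \<le> Suc j * (m choose Suc j)"
    by (metis mult.assoc mult_le_mono1)
  then show ?thesis by (simp only: mult_le_cancel1)
qed

lemma binomial_ratio_power:
  assumes "Suc r * (j + c) \<le> m" shows "r ^ c * (m choose j) \<le> m choose (j + c)"
  using assms
proof (induction c)
  case (Suc c)
  have "Suc r * (j + c) \<le> Suc r * (j + Suc c)" by (intro mult_le_mono) auto
  then have "r ^ c * (m choose j) \<le> m choose (j + c)" using Suc by linarith
  then have "r * (r ^ c * (m choose j)) \<le> r * (m choose (j + c))" by simp
  also have "\<dots> \<le> m choose (j + Suc c)" using binomial_ratio[of r "j + c" m] Suc.prems by simp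
  finally show ?case by (simp add: mult.assoc)
qed simp

text \<open>After division this reads
  \<open>|P| / (m choose p) + |Q| / (m choose q) \<le> 1\<close>. Count disjoint pairs between
  \<open>Q\<close> and the complement \<open>N\<close> of \<open>P\<close>: all
  \<open>p\<close>-sets disjoint from a member of \<open>Q\<close> lie in \<open>N\<close>.\<close>

lemma cross_normalized:
  assumes V: "finite V" and P: "P \<subseteq> ksets V p" and Q: "Q \<subseteq> ksets V q"
    and cr: "cross 1 P Q" and pq: "p + q \<le> card V"
  shows "card Q * (card V choose p) + card P * (card V choose q) \<le> (card V choose p) * (card V choose q)"
proof -
  let ?m = "card V"
  define N where "N = ksets V p - P"
  have fin: "finite N" "finite Q" "finite P" using V P Q finite_family by (auto simp: N_def finite_ksets)
  have cN: "card N + card P = ?m choose p"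
    using card_Diff_subset[OF fin(3) P] card_family_le[OF V P] n_subsets[OF V, of p] by (simp add: N_def)
  have "(\<Sum>Y\<in>Q. \<Sum>X\<in>{X\<in>N. X \<inter> Y = {}}. 1) = (\<Sum>X\<in>N. \<Sum>Y\<in>{Y\<in>Q. X \<inter> Y = {}}. (1::nat))"
    by (rule sum.swap_restrict[OF fin(2,1)])
  then have dc: "(\<Sum>Y\<in>Q. card {X\<in>N. X \<inter> Y = {}}) = (\<Sum>X\<in>N. card {Y\<in>Q. X \<inter> Y = {}})" by simp
  have l: "card {X\<in>N. X \<inter> Y = {}} = (?m - q) choose p" if "Y \<in> Q" for Y
  proof -
    have "{X\<in>N. X \<inter> Y = {}} = {X. X \<subseteq> V - Y \<and> card X = p}"
    proof (intro equalityI subsetI)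
      fix X assume X: "X \<in> {X. X \<subseteq> V - Y \<and> card X = p}"
      then have "X \<inter> Y = {}" by auto
      moreover have "X \<notin> P"
      proof
        assume "X \<in> P"
        then have "1 \<le> card (X \<inter> Y)" using cr that by (simp add: cross_def)
        then show False using \<open>X \<inter> Y = {}\<close> by simp
      qed
      ultimately show "X \<in> {X\<in>N. X \<inter> Y = {}}" using X by (auto simp: N_def)
    qed (auto simp: N_def)
    moreover have "card (V - Y) = ?m - q" using that Q V by (auto intro!: card_Diff_subset intro: finite_subset)
    ultimately show ?thesis using n_subsets[of "V - Y" p] V by simp
  qed
  have r: "card {Y\<in>Q. X \<inter> Y = {}} \<le> (?m - p) choose q" if "X \<in> N" for X
  proof -
    have "card {Y\<in>Q. X \<inter> Y = {}} \<le> card (V - X) choose q"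
      using Q V by (intro card_family_le) auto
    moreover have "card (V - X) = ?m - p" using that V by (auto simp: N_def intro!: card_Diff_subset intro: finite_subset)
    ultimately show ?thesis by simp
  qed
  have le: "card Q * ((?m - q) choose p) \<le> card N * ((?m - p) choose q)"
    using dc l sum_bounded_above[of N "\<lambda>X. card {Y\<in>Q. X \<inter> Y = {}}", OF r] by simp
  have id: "(?m choose q) * ((?m - q) choose p) = (?m choose p) * ((?m - p) choose q)"
    using choose_mult[of p "p + q" ?m] choose_mult[of q "p + q" ?m] pq binomial_symmetric[of p "p + q"] by simp
  have "card Q * (?m choose p) * ((?m - p) choose q) = (?m choose q) * (card Q * ((?m - q) choose p))"
    using id by (simp add: algebra_simps)
  also have "\<dots> \<le> (?m choose q) * (card N * ((?m - p) choose q))" using le by simp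
  finally have "card Q * (?m choose p) * ((?m - p) choose q) \<le> (card N * (?m choose q)) * ((?m - p) choose q)"
    by (simp add: algebra_simps)
  moreover have "0 < (?m - p) choose q" using pq by simp
  ultimately have "card Q * (?m choose p) \<le> card N * (?m choose q)" by (simp only: mult_le_cancel2)
  then show ?thesis using cN by (metis add_mult_distrib add_le_mono1)
qed

text \<open>Induction on the first element of \<open>V\<close>: it lowers \<open>a\<close> by one on the sets of \<open>Q\<close> containing it,
  which are paired with the sets of \<open>P\<close> avoiding it, and vice versa. The equation \<open>q + c = p + a\<close> is
  invariant, so at the hitting time \<open>a = 0\<close> normalized matching applies with \<open>q = p - c\<close>.\<close>

lemma hits_ratio:
  assumes "finite V" "P \<subseteq> ksets V p" "Q \<subseteq> ksets V q" "cross 1 P Q" "\<And>Y. Y \<in> Q \<Longrightarrow> hits V Y a"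
    and "q + c = p + a" "0 < c" "Suc r * p + 2 * q \<le> card V"
  shows "card P + r ^ c * card Q \<le> card V choose p"
  using assms
proof (induction "card V" arbitrary: V P Q p q a)
  case 0
  then have "p = 0" "q = 0" by auto
  show ?case
  proof (cases "Q = {}")
    case True then show ?thesis using card_family_le[OF 0(2,3)] by simp
  next
    case False
    then obtain Y where "Y \<in> Q" by blast
    then have "a \<le> 0" using hits_le_card[OF 0(6)] 0 \<open>q = 0\<close> by fastforce
    then show ?thesis using 0 \<open>p = 0\<close> by simp
  qed
next
  case (Suc m)
  show ?case
  proof (cases "Q = {} \<or> a = 0")
    case True
    show ?thesis
    proof (cases "Q = {}")
      case True then show ?thesis using card_family_le[OF Suc.prems(1,2)] by simp
    next
      case False
      then have a: "p = q + c" using True Suc.prems by simp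
      let ?A = "card V choose p" and ?B = "card V choose q"
      have pq: "p + q \<le> card V" using Suc.prems(8) by simp
      have "r ^ c * ?B \<le> ?A" using binomial_ratio_power[of r q c "card V"] a Suc.prems(8) by simp
      then have "card Q * (r ^ c * ?B) \<le> card Q * ?A" by (rule mult_le_mono2)
      then have "card P * ?B + card Q * (r ^ c * ?B) \<le> ?A * ?B"
        using cross_normalized[OF Suc.prems(1-4) pq] by linarith
      then have "(card P + r ^ c * card Q) * ?B \<le> ?A * ?B" by (simp add: algebra_simps)
      moreover have "0 < ?B" using pq by simp
      ultimately show ?thesis by (simp only: mult_le_cancel2)
    qed
  next
    case False
    then obtain Y where Y: "Y \<in> Q" by blast
    have aq: "a \<le> q" using hits_le_card[OF Suc.prems(5)[OF Y]] Y Suc.prems by auto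
    obtain a' where a': "a = Suc a'" using False by (cases a) auto
    obtain q' where q': "q = Suc q'" using aq a' by (cases q) auto
    \<comment> \<open>Positive because \<open>p = c + (q - a)\<close> with \<open>a \<le> q\<close>
      and \<open>0 < c\<close>.\<close>
    obtain p' where p': "p = Suc p'" using aq Suc.prems(6,7) by (cases p) auto
    define v where "v = Min V"
    have "V \<noteq> {}" using Suc.hyps(2) by auto
    then have v: "v \<in> V" "\<And>w. w \<in> V \<Longrightarrow> v \<le> w" using Suc.prems by (auto simp: v_def)
    define W where "W = V - {v}"
    have W: "finite W" "card W = m" using Suc v by (auto simp: W_def)
    define P1 where "P1 = trace {v} {v} P"
    define P0 where "P0 = trace {v} {} P"
    define Q1 where "Q1 = trace {v} {v} Q"
    define Q0 where "Q0 = trace {v} {} Q"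
    have Pow: "P \<subseteq> Pow V" "Q \<subseteq> Pow V" using Suc.prems by auto
    have P1: "P1 \<subseteq> ksets W p'" unfolding P1_def W_def using Suc.prems p' by (intro trace_ksets) auto
    have P0: "P0 \<subseteq> ksets W p" unfolding P0_def W_def using Suc.prems by (intro trace_ksets) auto
    have Q1: "Q1 \<subseteq> ksets W q'" unfolding Q1_def W_def using Suc.prems q' by (intro trace_ksets) auto
    have Q0: "Q0 \<subseteq> ksets W q" unfolding Q0_def W_def using Suc.prems by (intro trace_ksets) auto
    have c10: "cross 1 P1 Q0" and c01: "cross 1 P0 Q1"
      unfolding P1_def P0_def Q1_def Q0_def
      by (rule cross_trace[OF Suc.prems(1) Pow Suc.prems(4)], simp)+
    have h1: "hits W Y a'" if "Y \<in> Q1" for Y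
    proof -
      obtain X where X: "X \<in> Q" "v \<in> X" "Y = X - {v}" using \<open>Y \<in> Q1\<close> unfolding Q1_def trace_def by blast
      then show ?thesis unfolding W_def X(3)
        using hits_Min_in[OF Suc.prems(1) _ X(2) v(2)] Suc.prems(3,5) a' by auto
    qed
    have h0: "hits W Y (Suc a)" if "Y \<in> Q0" for Y
    proof -
      have X: "Y \<in> Q" "v \<notin> Y" using that by (auto simp: Q0_def trace_def)
      then show ?thesis unfolding W_def
        using hits_Min_notin[OF Suc.prems(1) _ v(1) X(2) v(2) Suc.prems(5)[OF X(1)]] Suc.prems(3) a' by auto
    qed
    have split: "card R = card (trace {v} {v} R) + card (trace {v} {} R)" if "finite R" for R
    proof -
      have eq: "{X \<in> R. X \<inter> {v} = {v}} \<union> {X \<in> R. X \<inter> {v} = {}} = R" by auto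
      have "card ({X \<in> R. X \<inter> {v} = {v}} \<union> {X \<in> R. X \<inter> {v} = {}})
          = card {X \<in> R. X \<inter> {v} = {v}} + card {X \<in> R. X \<inter> {v} = {}}"
        using that by (intro card_Un_disjoint) auto
      then show ?thesis unfolding eq card_trace .
    qed
    have cP: "card P = card P1 + card P0" and cQ: "card Q = card Q1 + card Q0"
      unfolding P1_def P0_def Q1_def Q0_def
      using split finite_family[OF Suc.prems(1)] Suc.prems(2,3) by blast+
    \<comment> \<open>The ground set loses one element, but so does either \<open>p\<close> or
      \<open>q\<close>, so the size condition passes to both pairs.\<close>
    have s: "Suc r * p' + 2 * q \<le> card W" "Suc r * p + 2 * q' \<le> card W"
      using Suc.prems(8) Suc.hyps(2) W p' q' by auto
    have i1: "card P1 + r ^ c * card Q0 \<le> card W choose p'"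
      using Suc.prems(6,7) p' by (intro Suc.hyps(1)[OF W(2)[symmetric] W(1) P1 Q0 c10 h0 _ _ s(1)]) auto
    have i0: "card P0 + r ^ c * card Q1 \<le> card W choose p"
      using Suc.prems(6,7) q' a' by (intro Suc.hyps(1)[OF W(2)[symmetric] W(1) P0 Q1 c01 h1 _ _ s(2)]) auto
    have "card V choose p = (card W choose p') + (card W choose p)"
      using Suc.hyps(2) W p' by (metis binomial_Suc_Suc)
    then show ?thesis using i1 i0 cP cQ by (simp add: algebra_simps)
  qed
qed

section \<open>The dichotomy for cross-intersecting pairs\<close>

lemma cross_to_shifted:
  assumes "finite V" "P \<subseteq> ksets V p" "Q \<subseteq> ksets V q" "cross t P Q"
  obtains P' Q' where "P' \<subseteq> ksets V p" "Q' \<subseteq> ksets V q" "cross t P' Q'" "card P' = card P" "card Q' = card Q"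
    "shifted V P'" "shifted V Q'"
proof -
  define I where "I A B \<longleftrightarrow> A \<subseteq> ksets V p \<and> B \<subseteq> ksets V q \<and> cross t A B \<and> card A = card P \<and> card B = card Q" for A B
  have "\<exists>P' Q'. P' \<subseteq> Pow V \<and> Q' \<subseteq> Pow V \<and> I P' Q' \<and> shifted V P' \<and> shifted V Q'"
  proof (rule shift_to_shifted)
    show "I P Q" using assms by (simp add: I_def)
    fix A B i j assume I: "I A B" and "i \<in> V" "j \<in> V" "i < j"
    have fin: "finite X" if "X \<in> A \<or> X \<in> B" for X
      using that I finite_subset[of X V] assms(1) unfolding I_def by auto
    show "I (shift i j A) (shift i j B)"
      unfolding I_def
    proof (intro conjI)
      show "shift i j A \<subseteq> ksets V p" "shift i j B \<subseteq> ksets V q"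
        using I \<open>i \<in> V\<close> shift_ksets[OF assms(1)] unfolding I_def by simp_all
      show "cross t (shift i j A) (shift i j B)"
        using I fin \<open>i < j\<close> by (intro cross_shift) (auto simp: I_def)
    qed (use I in \<open>simp_all add: card_shift I_def\<close>)
  qed (use assms in auto)
  then obtain P' Q' where *: "I P' Q'" "shifted V P'" "shifted V Q'" by blast
  show ?thesis by (rule that[of P' Q']) (use * in \<open>auto simp: I_def\<close>)
qed

text \<open>The original families need not hit anything; shifted copies of the same sizes do. The
  bounds derived from this concern sizes only, so they transfer back.\<close>

definition hit_witness :: "nat set \<Rightarrow> nat \<Rightarrow> nat \<Rightarrow> nat \<Rightarrow> nat set set \<Rightarrow> nat set set \<Rightarrow> bool" where
  "hit_witness V p q a P Q \<longleftrightarrow> (\<exists>P' Q'. P' \<subseteq> ksets V p \<and> Q' \<subseteq> ksets V q \<and> cross 1 P' Q' \<and>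
     card P' = card P \<and> card Q' = card Q \<and> (\<forall>Y\<in>Q'. hits V Y a))"

lemma hit_witness_bound:
  assumes "finite V" "hit_witness V p q a P Q" shows "card Q \<le> chm (card V) q a"
proof -
  obtain Q' where Q': "Q' \<subseteq> ksets V q" "card Q' = card Q" "\<forall>Y\<in>Q'. hits V Y a"
    using assms(2) by (auto simp: hit_witness_def)
  then have "Q' \<subseteq> {X. X \<subseteq> V \<and> card X = q \<and> hits V X a}" by auto
  then have "card Q' \<le> card {X. X \<subseteq> V \<and> card X = q \<and> hits V X a}"
    using assms(1) by (intro card_mono) (auto intro: finite_subset[OF _ finite_ksets[of V q]])
  then show ?thesis using card_hits_le[OF assms(1), of q a] Q' by simp
qed

lemma hit_witness_ratio:
  assumes "finite V" "hit_witness V p q a P Q" "q + c = p + a" "0 < c" "Suc r * p + 2 * q \<le> card V"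
  shows "card P + r ^ c * card Q \<le> card V choose p"
proof -
  obtain P' Q' where "P' \<subseteq> ksets V p" "Q' \<subseteq> ksets V q" "cross 1 P' Q'" "card P' = card P" "card Q' = card Q"
    "\<forall>Y\<in>Q'. hits V Y a" using assms(2) by (auto simp: hit_witness_def)
  then show ?thesis using hits_ratio[OF assms(1) _ _ _ _ assms(3-5), of P' Q'] by simp
qed

text \<open>At most \<open>chm (card V) p b\<close> sets reach level \<open>b\<close>, so the
  shifted copy of \<open>P\<close> has a member that does not, and \<open>shifted_cross_hits\<close>
  lifts every member of the copy of \<open>Q\<close> to level \<open>a\<close>.\<close>

lemma cross_hit_witness:
  assumes "finite V" "P \<subseteq> ksets V p" "Q \<subseteq> ksets V q" "cross t P Q" "0 < t"
    and "chm (card V) p b < card P" "a + b = Suc (2 * t)"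
  shows "hit_witness V p q a P Q"
proof -
  obtain P' Q' where *: "P' \<subseteq> ksets V p" "Q' \<subseteq> ksets V q" "cross t P' Q'" "card P' = card P" "card Q' = card Q"
    "shifted V P'" "shifted V Q'" using cross_to_shifted[OF assms(1-4)] .
  have "\<not> P' \<subseteq> {X. X \<subseteq> V \<and> card X = p \<and> hits V X b}"
  proof
    assume "P' \<subseteq> {X. X \<subseteq> V \<and> card X = p \<and> hits V X b}"
    then have "card P' \<le> card {X. X \<subseteq> V \<and> card X = p \<and> hits V X b}"
      using assms(1) by (intro card_mono) (auto intro: finite_subset[OF _ finite_ksets[of V p]])
    then show False using card_hits_le[OF assms(1), of p b] assms(6) * by simp
  qed
  then obtain X where X: "X \<in> P'" "\<not> hits V X b" using * by blast
  have "hits V Y a" if "Y \<in> Q'" for Y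
    using shifted_cross_hits[OF assms(1) _ _ *(7) *(3) assms(5) X(1) that X(2) assms(7)] * by blast
  moreover have "cross 1 P' Q'" using *(3) assms(5) unfolding cross_def by (fastforce dest: bspec)
  ultimately show ?thesis unfolding hit_witness_def using * by blast
qed

text \<open>For \<open>t = 1\<close> the general dichotomy with \<open>b = 1\<close> yields only
  level 2. One more level comes from a member \<open>X\<close> of the shifted \<open>P\<close> that
  avoids the two smallest elements and stays below 2 afterwards, so that its walk lies below 0 from
  the second element on.\<close>

lemma cross_hit_witness_3:
  assumes V: "finite V" "2 \<le> card V" and "P \<subseteq> ksets V p" "Q \<subseteq> ksets V q" "cross 1 P Q"
    and big: "2 * chm (card V - 1) p 1 + chm (card V - 2) p 2 < card P"
  shows "hit_witness V p q 3 P Q"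
proof -
  obtain P' Q' where *: "P' \<subseteq> ksets V p" "Q' \<subseteq> ksets V q" "cross 1 P' Q'" "card P' = card P" "card Q' = card Q"
    "shifted V P'" "shifted V Q'" using cross_to_shifted[OF assms(1,3-5)] .
  have Pow: "P' \<subseteq> Pow V" "Q' \<subseteq> Pow V" using * by auto
  define v where "v = Min V"
  have "V \<noteq> {}" using V by auto
  then have v: "v \<in> V" "\<And>x. x \<in> V \<Longrightarrow> v \<le> x" using V by (auto simp: v_def)
  define w where "w = Min (V - {v})"
  have "card (V - {v}) \<noteq> 0" using V v by simp
  then have "V - {v} \<noteq> {}" by (metis card.empty)
  then have "w \<in> V - {v}" "\<And>x. x \<in> V - {v} \<Longrightarrow> w \<le> x"
    using V Min_in[of "V - {v}"] by (auto simp: w_def)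
  then have w: "w \<in> V" "w \<noteq> v" "v < w" "\<And>x. x \<in> V \<Longrightarrow> x \<noteq> v \<Longrightarrow> w \<le> x" using v(2) by force+
  define W where "W = V - {v, w}"
  have W: "finite W" "card W = card V - 2" using V v w by (auto simp: W_def card_Diff_subset)
  \<comment> \<open>The three parts are counted by the three terms of the hypothesis
    \<open>big\<close>.\<close>
  have "\<not> P' \<subseteq> {X\<in>P'. {v} \<subseteq> X} \<union> {X\<in>P'. {w} \<subseteq> X} \<union> {X. X \<subseteq> W \<and> card X = p \<and> hits W X 2}"
  proof
    assume sub: "P' \<subseteq> {X\<in>P'. {v} \<subseteq> X} \<union> {X\<in>P'. {w} \<subseteq> X} \<union> {X. X \<subseteq> W \<and> card X = p \<and> hits W X 2}"
    have fin: "finite P'" using * V finite_family by blast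
    have "card P' \<le> card ({X\<in>P'. {v} \<subseteq> X} \<union> {X\<in>P'. {w} \<subseteq> X} \<union> {X. X \<subseteq> W \<and> card X = p \<and> hits W X 2})"
      using W fin by (intro card_mono[OF _ sub]) (auto intro: finite_subset[OF _ finite_ksets[of W p]])
    also have "\<dots> \<le> card {X\<in>P'. {v} \<subseteq> X} + card {X\<in>P'. {w} \<subseteq> X} + card {X. X \<subseteq> W \<and> card X = p \<and> hits W X 2}"
      using card_Un_le[of "{X\<in>P'. {v} \<subseteq> X} \<union> {X\<in>P'. {w} \<subseteq> X}" "{X. X \<subseteq> W \<and> card X = p \<and> hits W X 2}"]
        card_Un_le[of "{X\<in>P'. {v} \<subseteq> X}" "{X\<in>P'. {w} \<subseteq> X}"] by linarith
    also have "\<dots> \<le> chm (card V - 1) p 1 + chm (card V - 1) p 1 + chm (card V - 2) p 2"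
      using card_superset_le[OF V(1) *(1), of "{v}"] card_superset_le[OF V(1) *(1), of "{w}"]
        card_hits_le[OF W(1), of p 2] v(1) w(1) W(2) by (intro add_mono) auto
    finally show False using big * by simp
  qed
  then obtain X where X: "X \<in> P'" "v \<notin> X" "w \<notin> X" "\<not> hits W X 2" using * by (auto simp: W_def)
  have "hits V Y 3" if Y: "Y \<in> Q'" for Y
  proof -
    obtain j where j: "card (V \<inter> {..<j}) + 1 \<le> card (X \<inter> {..<j}) + card (Y \<inter> {..<j})"
      using shifted_cross_prefix[OF V(1) Pow *(7) *(3) _ X(1) Y] by auto
    have le: "card (Y \<inter> {..<j}) \<le> card (V \<inter> {..<j})" using *(2) Y V by (intro card_mono) auto
    \<comment> \<open>Up to \<open>w\<close> the set \<open>X\<close> is empty, so \<open>Y\<close>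
      alone would need more elements than \<open>V\<close> has there.\<close>
    have wj: "w < j"
    proof (rule ccontr)
      assume "\<not> w < j"
      then have "x \<notin> {..<j}" if "x \<in> X" for x
      proof -
        have "x \<in> V" "x \<noteq> v" using that X(1,2) Pow(1) by auto
        then show ?thesis using w(4)[of x] \<open>\<not> w < j\<close> by simp
      qed
      then have "X \<inter> {..<j} = {}" by blast
      then show False using j le by simp
    qed
    have "card (V \<inter> {..<j}) = Suc (card ((V - {v}) \<inter> {..<j}))"
      by (rule card_first_step) (use V v(1) w(1-3) wj in simp_all)
    moreover have "card ((V - {v}) \<inter> {..<j}) = Suc (card (W \<inter> {..<j}))"
    proof -
      have "W = V - {v} - {w}" by (auto simp: W_def)
      then show ?thesis using card_first_step[of "V - {v}" w j] V(1) w(1-3) wj by simp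
    qed
    moreover have "2 * card (X \<inter> {..<j}) < card (W \<inter> {..<j}) + 2"
      using X(4) by (auto simp: hits_def not_le)
    ultimately have "card (V \<inter> {..<j}) + 3 \<le> 2 * card (Y \<inter> {..<j})" using j by linarith
    then show ?thesis by (auto simp: hits_def)
  qed
  then show ?thesis unfolding hit_witness_def using * by (intro exI[of _ P'] exI[of _ Q']) simp
qed

section \<open>Heavy vertices of intersecting families\<close>

lemma cross_sym: "cross t P Q \<Longrightarrow> cross t Q P"
  unfolding cross_def by (metis Int_commute)

lemma hits_mono: "hits V X a \<Longrightarrow> b \<le> a \<Longrightarrow> hits V X b"
  unfolding hits_def by (meson add_le_mono le_refl le_trans)

lemma chm_mono: "m \<le> m' \<Longrightarrow> chm m b h \<le> chm m' b h"
  by (simp add: chm_def binomial_right_mono)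

lemma chm_Suc_Suc_3 [simp]: "chm m (Suc (Suc p)) 3 = chm m p 1"
  by (simp add: chm_def)

lemma chm_Suc_2 [simp]: "chm m (Suc p) 2 = chm m p 1"
  by (auto simp: chm_def)

lemma chm_2_le: "chm (m - 2) p 2 \<le> chm (m - 1) p 1" if "2 \<le> m"
proof -
  define r where "r = m - 2"
  have m: "m = Suc (Suc r)" using that by (simp add: r_def)
  show ?thesis
  proof (cases p)
    case (Suc q)
    then show ?thesis unfolding m by (cases q) (simp_all add: chm_def)
  qed (simp add: chm_def)
qed

lemma card_cover_le:
  assumes "A \<subseteq> B \<union> C" "finite B" "finite C" shows "card A \<le> card B + card C"
  using card_mono[OF _ assms(1)] card_Un_le[of B C] assms by simp

lemma card_degree_split:
  "finite P \<Longrightarrow> card P = card {X \<in> P. y \<in> X} + card {X \<in> P. y \<notin> X}"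
  by (subst card_Un_disjoint[symmetric]) (auto intro: arg_cong[where f = card])

lemma trace_avoid: "y \<notin> D \<Longrightarrow> {Z \<in> trace D S P. y \<notin> Z} = trace D S {X \<in> P. y \<notin> X}"
  unfolding trace_def by blast

lemma first_element:
  fixes V :: "nat set"
  assumes "finite V" "V \<noteq> {}"
  obtains v where "v \<in> V" "\<And>w. w \<in> V \<Longrightarrow> v \<le> w"
  using assms Min_in Min_le by metis

lemma card_hits_subset:
  assumes "finite V" "P \<subseteq> {X. X \<subseteq> V \<and> card X = b \<and> hits V X a}"
  shows "card P \<le> chm (card V) b a"
proof -
  have "card P \<le> card {X. X \<subseteq> V \<and> card X = b \<and> hits V X a}"
    using assms by (intro card_mono) (auto intro: finite_subset[OF _ finite_ksets[of V b]])
  then show ?thesis using card_hits_le[OF assms(1), of b a] by simp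
qed

text \<open>Apply \<open>cross_hit_witness_3\<close> to the link of the pair and the members
  avoiding it. The bound \<open>3 * U\<close> dominates the three counting terms there, and level 3
  on \<open>p + 2\<close>-sets gives \<open>p - 1\<close> in the binomial.\<close>

lemma big_pair_cover:
  fixes V :: "nat set"
  assumes V: "finite V" "4 \<le> card V" and B: "B \<subseteq> ksets V (Suc (Suc p))" "cross 1 B B"
    and xy: "x \<in> V" "y \<in> V" "x \<noteq> y" and U: "chm (card V - 2) p 1 \<le> U"
    and big: "3 * U < card {X \<in> B. x \<in> X \<and> y \<in> X}"
  shows "card {X \<in> B. x \<notin> X \<and> y \<notin> X} \<le> U"
proof -
  let ?D = "{x, y}"
  have c: "card (V - ?D) = card V - 2" using xy V by (simp add: card_Diff_subset)
  have "{X \<in> B. x \<in> X \<and> y \<in> X} = {X \<in> B. X \<inter> ?D = ?D}" "{X \<in> B. x \<notin> X \<and> y \<notin> X} = {X \<in> B. X \<inter> ?D = {}}"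
    by auto
  then have eq: "card {X \<in> B. x \<in> X \<and> y \<in> X} = card (trace ?D ?D B)"
    "card {X \<in> B. x \<notin> X \<and> y \<notin> X} = card (trace ?D {} B)" by (simp_all add: card_trace)
  have Pow: "B \<subseteq> Pow V" using B by auto
  have w: "hit_witness (V - ?D) p (Suc (Suc p)) 3 (trace ?D ?D B) (trace ?D {} B)"
  proof (rule cross_hit_witness_3)
    show "trace ?D ?D B \<subseteq> ksets (V - ?D) p" using V B xy by (intro trace_ksets) auto
    show "trace ?D {} B \<subseteq> ksets (V - ?D) (Suc (Suc p))" using V B by (intro trace_ksets) auto
    show "cross 1 (trace ?D ?D B) (trace ?D {} B)" by (rule cross_trace[OF V(1) Pow Pow B(2)]) simp
    have "chm (card V - 2 - 1) p 1 \<le> U" "chm (card V - 2 - 2) p 2 \<le> U"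
      using U V chm_mono[OF diff_le_self, of "card V - 2" 1 p 1] chm_2_le[of "card V - 2" p] by linarith+
    then show "2 * chm (card (V - ?D) - 1) p 1 + chm (card (V - ?D) - 2) p 2 < card (trace ?D ?D B)"
      using big c eq by simp
  qed (use V c in auto)
  show ?thesis using hit_witness_bound[OF _ w] V(1) c eq U by simp
qed

lemma big_pair_card:
  fixes V :: "nat set"
  assumes "finite V" "4 \<le> card V" "B \<subseteq> ksets V (Suc (Suc p))" "cross 1 B B"
    and "x \<in> V" "y \<in> V" "x \<noteq> y" "chm (card V - 2) p 1 \<le> U" "3 * U < card {X \<in> B. x \<in> X \<and> y \<in> X}"
  shows "card B \<le> card {X \<in> B. x \<in> X} + card {X \<in> B. y \<in> X} + U"
proof -
  have "finite B" using assms finite_family by blast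
  have "B = {X \<in> B. x \<in> X} \<union> {X \<in> B. y \<in> X} \<union> {X \<in> B. x \<notin> X \<and> y \<notin> X}" by auto
  then have "card B \<le> card {X \<in> B. x \<in> X} + card {X \<in> B. y \<in> X} + card {X \<in> B. x \<notin> X \<and> y \<notin> X}"
    by (metis (no_types, lifting) add_le_mono1 card_Un_le le_trans)
  then show ?thesis using big_pair_cover[OF assms] by linarith
qed

text \<open>The link of \<open>y\<close> in \<open>B\<close> is cross-intersecting with the members
  of \<open>A\<close> avoiding \<open>y\<close>; a link of more than \<open>U\<close> sets forces
  level 2 on the latter.\<close>

lemma cross_degree_dichotomy:
  fixes V :: "nat set"
  assumes V: "finite V" and A: "A \<subseteq> ksets V (Suc p)" and B: "B \<subseteq> ksets V (Suc p)" and cr: "cross 1 A B"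
    and y: "y \<in> V" and U: "chm (card V - 1) p 1 \<le> U" and big: "U < card {X \<in> B. y \<in> X}"
  shows "card {X \<in> A. y \<notin> X} \<le> U"
proof -
  have c: "card (V - {y}) = card V - 1" using V y by simp
  have "{X \<in> B. y \<in> X} = {X \<in> B. X \<inter> {y} = {y}}" "{X \<in> A. y \<notin> X} = {X \<in> A. X \<inter> {y} = {}}"
    by auto
  then have eq: "card {X \<in> B. y \<in> X} = card (trace {y} {y} B)"
    "card {X \<in> A. y \<notin> X} = card (trace {y} {} A)" by (simp_all add: card_trace)
  have Pow: "A \<subseteq> Pow V" "B \<subseteq> Pow V" using A B by auto
  have w: "hit_witness (V - {y}) p (Suc p) 2 (trace {y} {y} B) (trace {y} {} A)"
  proof (rule cross_hit_witness)
    show "trace {y} {y} B \<subseteq> ksets (V - {y}) p" using V B by (intro trace_ksets) auto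
    show "trace {y} {} A \<subseteq> ksets (V - {y}) (Suc p)" using V A by (intro trace_ksets) auto
    show "cross 1 (trace {y} {y} B) (trace {y} {} A)"
      by (rule cross_trace[OF V Pow(2,1) cross_sym[OF cr]]) simp
    show "chm (card (V - {y})) p 1 < card (trace {y} {y} B)" using U c eq big by simp
  qed (use V in auto)
  show ?thesis using hit_witness_bound[OF _ w] V(1) c eq U by simp
qed

text \<open>A vertex of degree above \<open>U\<close> in \<open>B\<close> is a centre by applying
  the dichotomy in both directions. If there is none, shifting keeps it so, and the shifted pair is
  contradictory.\<close>

lemma common_centre:
  fixes V :: "nat set"
  assumes V: "finite V" and A: "A \<subseteq> ksets V (Suc p)" and B: "B \<subseteq> ksets V (Suc p)" and cr: "cross 1 A B"
    and U: "chm (card V - 1) p 1 \<le> U" "chm (card V) p 1 \<le> 2 * U" and big: "2 * U < card A" "3 * U < card B"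
  shows "\<exists>y\<in>V. card {X \<in> A. y \<notin> X} \<le> U \<and> card {X \<in> B. y \<notin> X} \<le> U"
proof -
  have centre: "card {X \<in> A. y \<notin> X} \<le> U \<and> card {X \<in> B. y \<notin> X} \<le> U"
    if "A \<subseteq> ksets V (Suc p)" "B \<subseteq> ksets V (Suc p)" "cross 1 A B" "2 * U < card A"
      "y \<in> V" "U < card {X \<in> B. y \<in> X}" for A B y
  proof -
    have a: "card {X \<in> A. y \<notin> X} \<le> U" using cross_degree_dichotomy[OF V that(1-3,5) U(1) that(6)] .
    then have "U < card {X \<in> A. y \<in> X}"
      using card_degree_split[OF finite_family[OF V that(1)], of y] that(4) by linarith
    then show ?thesis using a cross_degree_dichotomy[OF V that(2,1) cross_sym[OF that(3)] that(5) U(1)] by blast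
  qed
  show ?thesis
  proof (cases "\<exists>y\<in>V. U < card {X \<in> B. y \<in> X}")
    case True then show ?thesis using centre[OF A B cr big(1)] by blast
  next
    case False
    define I where "I P Q \<longleftrightarrow> P \<subseteq> ksets V (Suc p) \<and> Q \<subseteq> ksets V (Suc p) \<and> cross 1 P Q \<and> card P = card A \<and>
      card Q = card B \<and> (\<forall>y\<in>V. card {X \<in> Q. y \<in> X} \<le> U)" for P Q
    have "\<exists>P' Q'. P' \<subseteq> Pow V \<and> Q' \<subseteq> Pow V \<and> I P' Q' \<and> shifted V P' \<and> shifted V Q'"
    proof (rule shift_to_shifted)
      show "I A B" using A B cr False by (auto simp: I_def not_less)
      fix P Q i j assume I: "I P Q" and ij: "i \<in> V" "j \<in> V" "i < j"
      let ?P = "shift i j P" and ?Q = "shift i j Q"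
      have PQ: "P \<subseteq> ksets V (Suc p)" "Q \<subseteq> ksets V (Suc p)" "cross 1 P Q" "card P = card A" "card Q = card B"
        and deg: "card {X \<in> Q. y \<in> X} \<le> U" if "y \<in> V" for y using I that by (auto simp: I_def)
      have PQ: "P \<subseteq> ksets V (Suc p)" "Q \<subseteq> ksets V (Suc p)" "cross 1 P Q" "card P = card A" "card Q = card B"
        using PQ ij by auto
      have fin: "finite X" if "X \<in> P \<or> X \<in> Q" for X
        using that PQ finite_subset[of X V] V by auto
      have fQ: "finite Q" using finite_family[OF V PQ(2)] .
      have new: "?P \<subseteq> ksets V (Suc p)" "?Q \<subseteq> ksets V (Suc p)" "cross 1 ?P ?Q"
        using shift_ksets[OF V ij(1) PQ(1)] shift_ksets[OF V ij(1) PQ(2)] PQ(3) fin ij(3)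
        by (auto intro!: cross_shift)
      \<comment> \<open>A degree that grows beyond \<open>U\<close> is still at most
        \<open>2 * U\<close>. As \<open>i\<close> would be a centre, at most \<open>U\<close>
        members avoid it, leaving no more than \<open>3 * U\<close> in all.\<close>
      have "card {X \<in> ?Q. i \<in> X} \<le> U"
      proof (rule ccontr)
        assume "\<not> card {X \<in> ?Q. i \<in> X} \<le> U"
        then have "card {X \<in> ?Q. i \<notin> X} \<le> U" using centre[OF new _ ij(1)] big PQ(4) by (simp add: card_shift)
        moreover have "card {X \<in> ?Q. i \<in> X} \<le> U + U"
          using degree_shift_target[OF fQ, of i j] deg[OF ij(1)] deg[OF ij(2)] by linarith
        moreover have "card ?Q = card B" using PQ by (simp add: card_shift)
        ultimately show False
          using card_degree_split[OF finite_family[OF V new(2)], of i] big(2) by linarith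
      qed
      moreover have "card {X \<in> ?Q. y \<in> X} \<le> U" if "y \<in> V" "y \<noteq> i" for y
        using degree_shift_other[of y i j Q] degree_shift_source[OF fQ, of i j] deg[OF that(1)] that(2) ij(3)
        by (cases "y = j") auto
      ultimately show "I ?P ?Q" using new PQ unfolding I_def by (auto simp: card_shift)
    qed (use V A B in auto)
    then obtain P Q where Pow: "P \<subseteq> Pow V" "Q \<subseteq> Pow V" and I: "I P Q" and sh: "shifted V Q" by blast
    have PQ: "P \<subseteq> ksets V (Suc p)" "Q \<subseteq> ksets V (Suc p)" "cross 1 P Q" "card P = card A" "card Q = card B"
      and deg: "\<And>y. y \<in> V \<Longrightarrow> card {X \<in> Q. y \<in> X} \<le> U" using I by (auto simp: I_def)
    \<comment> \<open>At most \<open>2 * U\<close> sets reach level 2, so some \<open>X\<close> does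
      not and every member of \<open>Q\<close> reaches level 1. Those avoiding the first element
      then reach level 2 on the rest, so \<open>Q\<close> has at most \<open>2 * U\<close>
      members.\<close>
    have "\<not> P \<subseteq> {X. X \<subseteq> V \<and> card X = Suc p \<and> hits V X 2}"
      using card_hits_subset[OF V, of P "Suc p" 2] U(2) big(1) PQ(4) by auto
    then obtain X where X: "X \<in> P" "\<not> hits V X 2" using PQ(1) by blast
    have h: "hits V Y 1" if "Y \<in> Q" for Y
      using shifted_cross_hits[OF V Pow sh PQ(3) _ X(1) that X(2)] by simp
    have "Q \<noteq> {}" using PQ(5) big(2) by auto
    then have "V \<noteq> {}" using PQ(2) by fastforce
    then obtain v where v: "v \<in> V" "\<And>w. w \<in> V \<Longrightarrow> v \<le> w" using first_element[OF V] by blast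
    have "{Y \<in> Q. v \<notin> Y} \<subseteq> {X. X \<subseteq> V - {v} \<and> card X = Suc p \<and> hits (V - {v}) X 2}"
    proof
      fix Y assume "Y \<in> {Y \<in> Q. v \<notin> Y}"
      then have Y: "Y \<in> Q" "v \<notin> Y" "Y \<subseteq> V" "card Y = Suc p" using PQ(2) by auto
      then show "Y \<in> {X. X \<subseteq> V - {v} \<and> card X = Suc p \<and> hits (V - {v}) X 2}"
        using hits_Min_notin[OF V Y(3) v(1) Y(2) v(2) h[OF Y(1)]] by (auto simp: numeral_2_eq_2)
    qed
    then have "card {Y \<in> Q. v \<notin> Y} \<le> U"
      using card_hits_subset[of "V - {v}" "{Y \<in> Q. v \<notin> Y}" "Suc p" 2] V v(1) U(1) by simp
    then show ?thesis
      using card_degree_split[OF finite_family[OF V PQ(2)], of v] deg[OF v(1)] PQ(5) big(2) by linarith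
  qed
qed

text \<open>If all degrees are at most \<open>8 * U\<close>, the members avoiding the first element
  nearly all contain the next two, \<open>v\<close> and \<open>w\<close>. This pair then covers all
  but \<open>U\<close> members, giving at most \<open>17 * U\<close> in total.\<close>

lemma shifted_heavy_vertex:
  fixes V :: "nat set"
  assumes V: "finite V" "4 \<le> card V" and H: "H \<subseteq> ksets V (Suc (Suc p))" "cross 1 H H" "shifted V H"
    and U: "chm (card V - 2) p 1 \<le> U" and big: "19 * U < card H"
  shows "\<exists>y\<in>V. 8 * U < card {X \<in> H. y \<in> X}"
proof (rule ccontr)
  assume "\<not> ?thesis"
  then have deg: "card {X \<in> H. y \<in> X} \<le> 8 * U" if "y \<in> V" for y using that by (auto simp: not_less)
  have fH: "finite H" using finite_family[OF V(1) H(1)] .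
  have Pow: "H \<subseteq> Pow V" using H by auto
  \<comment> \<open>Each member is paired with itself: missing level 1 would force level 2, which is
    absurd.\<close>
  have h: "hits V Y 1" if "Y \<in> H" for Y
    using shifted_cross_hits[OF V(1) Pow Pow H(3,2) _ that that, of 2 1] hits_mono[of V Y 2 1] by auto
  have "V \<noteq> {}" using V by auto
  then obtain u where u: "u \<in> V" "\<And>w. w \<in> V \<Longrightarrow> u \<le> w" using first_element[OF V(1)] by blast
  define V1 where "V1 = V - {u}"
  have V1: "finite V1" "card V1 = card V - 1" using V u by (auto simp: V1_def)
  then have "V1 \<noteq> {}" using V by fastforce
  then obtain v where v: "v \<in> V1" "\<And>w. w \<in> V1 \<Longrightarrow> v \<le> w" using first_element[OF V1(1)] by blast
  define V2 where "V2 = V1 - {v}"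
  have V2: "finite V2" "card V2 = card V - 2" using V1 v by (auto simp: V2_def)
  then have "V2 \<noteq> {}" using V by fastforce
  then obtain w where w: "w \<in> V2" "\<And>x. x \<in> V2 \<Longrightarrow> w \<le> x" using first_element[OF V2(1)] by blast
  define V3 where "V3 = V2 - {w}"
  have V3: "finite V3" "card V3 = card V - 3" using V2 w by (auto simp: V3_def)
  let ?E = "{X \<in> H. v \<in> X \<and> w \<in> X}"
  let ?F = "{X. X \<subseteq> V3 \<and> card X = Suc p \<and> hits V3 X 2}"
  let ?G = "{X. X \<subseteq> V2 \<and> card X = Suc (Suc p) \<and> hits V2 X 3}"
  have "{X \<in> H. u \<notin> X} \<subseteq> ?E \<union> insert v ` ?F \<union> ?G"
  proof
    fix X assume "X \<in> {X \<in> H. u \<notin> X}"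
    then have X: "X \<in> H" "u \<notin> X" "X \<subseteq> V" "card X = Suc (Suc p)" using H by auto
    have fX: "finite X" using X V finite_subset by blast
    have X1: "X \<subseteq> V1" using X by (auto simp: V1_def)
    have h1: "hits V1 X 2" unfolding V1_def
      using hits_Min_notin[OF V(1) X(3) u(1) X(2) u(2) h[OF X(1)]] by (simp add: numeral_2_eq_2)
    consider "v \<in> X" "w \<in> X" | "v \<in> X" "w \<notin> X" | "v \<notin> X" by blast
    then show "X \<in> ?E \<union> insert v ` ?F \<union> ?G"
    proof cases
      case 1 then show ?thesis using X by blast
    next
      case 2
      have "hits V2 (X - {v}) 1" unfolding V2_def
        using hits_Min_in[OF V1(1) X1 2(1) v(2)] h1 by (simp add: numeral_2_eq_2)
      then have "hits V3 (X - {v}) 2" unfolding V3_def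
        using hits_Min_notin[OF V2(1) _ w(1) _ w(2), of "X - {v}" 1] X1 2 by (auto simp: numeral_2_eq_2 V2_def)
      moreover have "X - {v} \<subseteq> V3" using X1 2 by (auto simp: V3_def V2_def)
      moreover have "card (X - {v}) = Suc p" using X(4) 2 fX by simp
      ultimately have "X - {v} \<in> ?F" by simp
      moreover have "X = insert v (X - {v})" using 2 by auto
      ultimately have "X \<in> insert v ` ?F" by (rule rev_image_eqI)
      then show ?thesis by blast
    next
      case 3
      have "hits V2 X 3" unfolding V2_def
        using hits_Min_notin[OF V1(1) X1 v(1) 3 v(2) h1] by (simp add: numeral_3_eq_3 numeral_2_eq_2)
      then show ?thesis using X X1 3 by (auto simp: V2_def)
    qed
  qed
  moreover have fF: "finite ?F" "finite ?G" using V3 V2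
    by (auto intro: finite_subset[OF _ finite_ksets[of V3 "Suc p"]] finite_subset[OF _ finite_ksets[of V2 "Suc (Suc p)"]])
  ultimately have "card {X \<in> H. u \<notin> X} \<le> card (?E \<union> insert v ` ?F \<union> ?G)"
    using fH by (intro card_mono) auto
  also have "\<dots> \<le> card ?E + card (insert v ` ?F) + card ?G"
    by (intro order.trans[OF card_Un_le] add_mono card_Un_le) auto
  also have "\<dots> \<le> card ?E + U + U"
  proof (intro add_mono)
    have "card (insert v ` ?F) \<le> card ?F" using fF by (intro card_image_le)
    also have "\<dots> \<le> chm (card V - 3) p 1" using card_hits_le[OF V3(1), of "Suc p" 2] V3 by simp
    also have "\<dots> \<le> U" by (rule order.trans[OF chm_mono U]) simp
    finally show "card (insert v ` ?F) \<le> U" .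
    show "card ?G \<le> U" using card_hits_le[OF V2(1), of "Suc (Suc p)" 3] V2 U by simp
  qed simp
  finally have "card {X \<in> H. u \<notin> X} \<le> card ?E + U + U" .
  then have "3 * U < card ?E" using card_degree_split[OF fH, of u] deg[OF u(1)] big by linarith
  moreover have vw: "v \<in> V" "w \<in> V" "v \<noteq> w" using v w by (auto simp: V1_def V2_def)
  ultimately have "card H \<le> card {X \<in> H. v \<in> X} + card {X \<in> H. w \<in> X} + U"
    using big_pair_card[OF V H(1,2) vw U] by blast
  then show False using deg[OF vw(1)] deg[OF vw(2)] big by linarith
qed

text \<open>Shift on \<open>V - {x}\<close> only, so the degree of \<open>x\<close> is frozen. A
  second vertex cannot pass \<open>8 * U\<close> during the process, yet the final family of members
  avoiding \<open>x\<close> is shifted and must have such a vertex.\<close>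

lemma no_single_heavy_vertex:
  fixes V :: "nat set"
  assumes V: "finite V" "5 \<le> card V" and B: "B \<subseteq> ksets V (Suc (Suc p))" "cross 1 B B"
    and U: "chm (card V - 2) p 1 \<le> U" and big: "35 * U < card B"
    and x: "x \<in> V" "8 * U < card {X \<in> B. x \<in> X}" "card {X \<in> B. x \<in> X} \<le> 16 * U"
    and oth: "\<And>y. y \<in> V \<Longrightarrow> y \<noteq> x \<Longrightarrow> card {X \<in> B. y \<in> X} \<le> 8 * U"
  shows False
proof -
  define I where "I P Q \<longleftrightarrow> P \<subseteq> ksets V (Suc (Suc p)) \<and> cross 1 P P \<and> card P = card B \<and>
      8 * U < card {X \<in> P. x \<in> X} \<and> card {X \<in> P. x \<in> X} \<le> 16 * U \<and>
      (\<forall>y\<in>V. y \<noteq> x \<longrightarrow> card {X \<in> P. y \<in> X} \<le> 8 * U)" for P Q :: "nat set set"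
  have "\<exists>P' Q'. P' \<subseteq> Pow V \<and> Q' \<subseteq> Pow V \<and> I P' Q' \<and> shifted (V - {x}) P' \<and> shifted (V - {x}) Q'"
  proof (rule shift_to_shifted)
    show "I B {}" using B x oth by (auto simp: I_def)
    fix P Q i j assume I: "I P Q" and "i \<in> V - {x}" "j \<in> V - {x}" and lt: "i < j"
    then have ij: "i \<in> V" "j \<in> V" "i \<noteq> x" "j \<noteq> x" "i \<noteq> j" by auto
    let ?C = "shift i j P"
    have P: "P \<subseteq> ksets V (Suc (Suc p))" "cross 1 P P" "card P = card B"
      "8 * U < card {X \<in> P. x \<in> X}" "card {X \<in> P. x \<in> X} \<le> 16 * U"
      and deg: "\<And>y. y \<in> V \<Longrightarrow> y \<noteq> x \<Longrightarrow> card {X \<in> P. y \<in> X} \<le> 8 * U" using I by (auto simp: I_def)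
    have fin: "finite X" if "X \<in> P" for X using that P finite_subset[of X V] V by auto
    have fP: "finite P" using finite_family[OF V(1) P(1)] .
    have C: "?C \<subseteq> ksets V (Suc (Suc p))" "cross 1 ?C ?C" "card ?C = card B"
      using shift_ksets[OF V(1) ij(1) P(1)] P fin ij(5) by (auto intro!: cross_shift simp: card_shift)
    have fC: "finite ?C" using finite_family[OF V(1) C(1)] .
    have dx: "card {X \<in> ?C. x \<in> X} = card {X \<in> P. x \<in> X}"
      using degree_shift_other[of x i j P] ij by simp
    have dy: "card {X \<in> ?C. y \<in> X} \<le> 8 * U" if "y \<in> V" "y \<noteq> x" "y \<noteq> i" for y
      using degree_shift_other[of y i j P] degree_shift_source[OF fP ij(5)] deg[OF that(1,2)] that(3)
      by (cases "y = j") auto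
    have di: "card {X \<in> ?C. i \<in> X} \<le> 16 * U"
      using degree_shift_target[OF fP, of i j] deg[OF ij(1,3)] deg[OF ij(2,4)] by linarith
    \<comment> \<open>Otherwise the pair would cover all but \<open>U\<close> members, giving at
      most \<open>(16 + 16 + 1) * U\<close>.\<close>
    have nobig: "card {X \<in> ?C. x \<in> X \<and> y \<in> X} \<le> 3 * U" if "y \<in> V" "y \<noteq> x" for y
    proof (rule ccontr)
      assume "\<not> ?thesis"
      then have "card ?C \<le> card {X \<in> ?C. x \<in> X} + card {X \<in> ?C. y \<in> X} + U"
        using big_pair_card[OF V(1) _ C(1,2) x(1) that(1) _ U] that(2) V(2) by simp
      moreover have "card {X \<in> ?C. y \<in> X} \<le> 16 * U" using dy[OF that] di by (cases "y = i") auto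
      ultimately show False using dx P(5) C(3) big by linarith
    qed
    have "card {X \<in> ?C. i \<in> X} \<le> 8 * U"
    proof (rule ccontr)
      assume "\<not> ?thesis"
      then have di': "8 * U < card {X \<in> ?C. i \<in> X}" by simp
      let ?D = "{x, i}"
      define A1 where "A1 = trace ?D {x} ?C"
      define A2 where "A2 = trace ?D {i} ?C"
      have cW: "card (V - ?D) = card V - 2" using V(1) x(1) ij by (simp add: card_Diff_subset)
      have s: "A1 \<subseteq> ksets (V - ?D) (Suc p)" "A2 \<subseteq> ksets (V - ?D) (Suc p)"
        unfolding A1_def A2_def using V(1) C by (auto intro!: trace_ksets del: subsetI)
      have Pow: "?C \<subseteq> Pow V" using C by auto
      have cr: "cross 1 A1 A2" unfolding A1_def A2_def
        by (rule cross_trace[OF V(1) Pow Pow C(2)]) (use ij in auto)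
      have "card {X \<in> ?C. x \<in> X} \<le> card A1 + card {X \<in> ?C. x \<in> X \<and> i \<in> X}"
        "card {X \<in> ?C. i \<in> X} \<le> card A2 + card {X \<in> ?C. x \<in> X \<and> i \<in> X}"
        unfolding A1_def A2_def card_trace using fC ij(3) by (auto intro!: card_cover_le)
      \<comment> \<open>From \<open>8 * U\<close> at most \<open>3 * U\<close> is lost to the common
        members. A common centre \<open>y\<close> then keeps more than \<open>4 * U\<close> members
        through \<open>x\<close> and \<open>y\<close>, against \<open>nobig\<close>.\<close>
      then have cA: "5 * U < card A1" "5 * U < card A2" using nobig[OF ij(1,3)] dx P(4) di' by linarith+
      have U': "chm (card (V - ?D) - 1) p 1 \<le> U" "chm (card (V - ?D)) p 1 \<le> 2 * U"
        using U cW chm_mono[OF diff_le_self, of "card V - 2" 1 p 1] by auto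
      obtain y where y: "y \<in> V - ?D" "card {X \<in> A1. y \<notin> X} \<le> U"
        using common_centre[OF _ s cr U'] cA V(1) by auto
      then have "card {X \<in> {X \<in> ?C. y \<notin> X}. X \<inter> ?D = {x}} \<le> U"
        using trace_avoid[of y ?D "{x}" ?C] card_trace[of ?D "{x}" "{X \<in> ?C. y \<notin> X}"] by (simp add: A1_def)
      moreover have "{X \<in> ?C. X \<inter> ?D = {x}} \<subseteq> {X \<in> ?C. x \<in> X \<and> y \<in> X} \<union> {X \<in> {X \<in> ?C. y \<notin> X}. X \<inter> ?D = {x}}"
        by auto
      then have "card {X \<in> ?C. X \<inter> ?D = {x}}
          \<le> card {X \<in> ?C. x \<in> X \<and> y \<in> X} + card {X \<in> {X \<in> ?C. y \<notin> X}. X \<inter> ?D = {x}}"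
        by (rule card_cover_le) (use fC in simp_all)
      ultimately have "3 * U < card {X \<in> ?C. x \<in> X \<and> y \<in> X}"
        using cA(1) unfolding A1_def card_trace by linarith
      then show False using nobig[of y] y(1) by auto
    qed
    then have "card {X \<in> ?C. y \<in> X} \<le> 8 * U" if "y \<in> V" "y \<noteq> x" for y using dy[OF that] by (cases "y = i") auto
    then show "I ?C (shift i j Q)" using C dx P(4,5) unfolding I_def by auto
  qed (use V B in auto)
  then obtain P Q where I: "I P Q" and sh: "shifted (V - {x}) P" by blast
  have P: "P \<subseteq> ksets V (Suc (Suc p))" "cross 1 P P" "card P = card B" "card {X \<in> P. x \<in> X} \<le> 16 * U"
    and deg: "\<And>y. y \<in> V \<Longrightarrow> y \<noteq> x \<Longrightarrow> card {X \<in> P. y \<in> X} \<le> 8 * U" using I by (auto simp: I_def)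
  have fP: "finite P" using finite_family[OF V(1) P(1)] .
  define H where "H = {X \<in> P. x \<notin> X}"
  have "\<exists>y\<in>V - {x}. 8 * U < card {X \<in> H. y \<in> X}"
  proof (rule shifted_heavy_vertex)
    show "H \<subseteq> ksets (V - {x}) (Suc (Suc p))" using P by (auto simp: H_def)
    show "cross 1 H H" using P(2) by (auto simp: H_def cross_def)
    show "shifted (V - {x}) H" using sh unfolding shifted_def H_def by auto
    show "chm (card (V - {x}) - 2) p 1 \<le> U" by (rule order.trans[OF chm_mono U]) (use x(1) V(1) in simp)
    \<comment> \<open>At most \<open>16 * U\<close> of more than \<open>35 * U\<close> members
      contain \<open>x\<close>.\<close>
    show "19 * U < card H" using card_degree_split[OF fP, of x] P big unfolding H_def by linarith
  qed (use V x in auto)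
  then obtain y where y: "y \<in> V" "y \<noteq> x" "8 * U < card {X \<in> H. y \<in> X}" by blast
  have "card {X \<in> H. y \<in> X} \<le> card {X \<in> P. y \<in> X}" using fP by (intro card_mono) (auto simp: H_def)
  then show False using y deg[OF y(1,2)] by linarith
qed

text \<open>Shift while all degrees stay at most \<open>8 * U\<close>. The first degree to exceed
  this at most doubles it, and only at the target vertex, which is the situation excluded by
  \<open>no_single_heavy_vertex\<close>.\<close>

lemma heavy_vertex:
  fixes V :: "nat set"
  assumes V: "finite V" "5 \<le> card V" and B: "B \<subseteq> ksets V (Suc (Suc p))" "cross 1 B B"
    and U: "chm (card V - 2) p 1 \<le> U" and big: "35 * U < card B"
  shows "\<exists>y\<in>V. 8 * U < card {X \<in> B. y \<in> X}"
proof (rule ccontr)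
  assume no: "\<not> ?thesis"
  define I where "I P Q \<longleftrightarrow> P \<subseteq> ksets V (Suc (Suc p)) \<and> cross 1 P P \<and> card P = card B \<and>
      (\<forall>y\<in>V. card {X \<in> P. y \<in> X} \<le> 8 * U)" for P Q :: "nat set set"
  have "\<exists>P' Q'. P' \<subseteq> Pow V \<and> Q' \<subseteq> Pow V \<and> I P' Q' \<and> shifted V P' \<and> shifted V Q'"
  proof (rule shift_to_shifted)
    show "I B {}" using B no by (auto simp: I_def not_less)
    fix P Q i j assume I: "I P Q" and ij: "i \<in> V" "j \<in> V" and lt: "i < j"
    let ?C = "shift i j P"
    have P: "P \<subseteq> ksets V (Suc (Suc p))" "cross 1 P P" "card P = card B"
      and deg: "\<And>y. y \<in> V \<Longrightarrow> card {X \<in> P. y \<in> X} \<le> 8 * U" using I by (auto simp: I_def)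
    have fin: "finite X" if "X \<in> P" for X using that P finite_subset[of X V] V by auto
    have fP: "finite P" using finite_family[OF V(1) P(1)] .
    have C: "?C \<subseteq> ksets V (Suc (Suc p))" "cross 1 ?C ?C" "card ?C = card B"
      using shift_ksets[OF V(1) ij(1) P(1)] P fin lt by (auto intro!: cross_shift simp: card_shift)
    have dy: "card {X \<in> ?C. y \<in> X} \<le> 8 * U" if "y \<in> V" "y \<noteq> i" for y
      using degree_shift_other[of y i j P] degree_shift_source[OF fP, of i j] deg[OF that(1)] that(2) lt
      by (cases "y = j") auto
    have di: "card {X \<in> ?C. i \<in> X} \<le> 16 * U"
      using degree_shift_target[OF fP, of i j] deg[OF ij(1)] deg[OF ij(2)] by linarith
    have "card {X \<in> ?C. i \<in> X} \<le> 8 * U"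
    proof (rule ccontr)
      assume "\<not> ?thesis"
      then show False
        using no_single_heavy_vertex[OF V C(1,2) U _ ij(1) _ di dy] C(3) big by simp
    qed
    then have "card {X \<in> ?C. y \<in> X} \<le> 8 * U" if "y \<in> V" for y using dy[OF that] by (cases "y = i") auto
    then show "I ?C (shift i j Q)" using C unfolding I_def by auto
  qed (use V B in auto)
  then obtain P Q where I: "I P Q" and sh: "shifted V P" by blast
  have P: "P \<subseteq> ksets V (Suc (Suc p))" "cross 1 P P" "card P = card B"
    and deg: "\<And>y. y \<in> V \<Longrightarrow> card {X \<in> P. y \<in> X} \<le> 8 * U" using I by (auto simp: I_def)
  have "\<exists>y\<in>V. 8 * U < card {X \<in> P. y \<in> X}"
    using shifted_heavy_vertex[OF V(1) _ P(1,2) sh U] V(2) P(3) big by simp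
  then show False using deg by (meson not_le)
qed

section \<open>Diversity\<close>

lemma chm_Suc_le_double: "chm (Suc m) p 1 \<le> 2 * chm m p 1" if "2 * p \<le> m"
proof (cases p)
  case (Suc q)
  show ?thesis
  proof (cases q)
    case (Suc r)
    have "1 * (m choose r) \<le> m choose Suc r"
      by (rule binomial_ratio) (use that \<open>p = Suc q\<close> Suc in simp)
    then show ?thesis using \<open>p = Suc q\<close> Suc by (simp add: chm_def)
  qed (simp add: chm_def Suc)
qed (simp add: chm_def)

text \<open>The constant 36 of the theorem is \<open>35 + 1\<close>, as required by
  \<open>binomial_ratio\<close> with factor 35, the one in \<open>heavy_vertex\<close>.\<close>

lemma chm_le_binomial: "36 * (p + 2) < n \<Longrightarrow> 35 * chm (n - 3) p 1 \<le> (n - 3) choose p"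
proof (cases p)
  case (Suc q)
  assume "36 * (p + 2) < n"
  then show ?thesis using binomial_ratio[of 35 q "n - 3"] Suc by (simp add: chm_def)
qed (simp add: chm_def)

lemma card_triple_le:
  assumes "finite W" "G \<subseteq> ksets W (Suc (Suc p))" "a \<in> W" "b \<in> W" "c \<in> W" "a \<noteq> b" "a \<noteq> c" "b \<noteq> c"
  shows "card {X \<in> G. a \<in> X \<and> b \<in> X \<and> c \<in> X} \<le> chm (card W - 3) p 1"
proof -
  have "{X \<in> G. a \<in> X \<and> b \<in> X \<and> c \<in> X} = {X \<in> G. {a, b, c} \<subseteq> X}" by auto
  moreover have "card {a, b, c} = 3" using assms(6-8) by simp
  moreover have "card {X \<in> G. {a, b, c} \<subseteq> X} \<le> chm (card W - card {a, b, c}) (Suc (Suc p)) (card {a, b, c})"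
    by (rule card_superset_le[OF assms(1,2)]) (use assms(3-5) in simp)
  ultimately show ?thesis by (simp only: chm_Suc_Suc_3)
qed

text \<open>Split \<open>G\<close> into eight parts by the pattern on \<open>x\<close>,
  \<open>y\<close>, \<open>z\<close>. Each heavy pair pays for the complementary singleton and the
  empty pattern, and averaging over the three vertices finds one of small diversity.\<close>

lemma triangle_diversity:
  fixes W :: "nat set"
  assumes W: "finite W" "36 * (p + 2) < card W" and G: "G \<subseteq> ksets W (Suc (Suc p))" "cross 1 G G"
    and xyz: "x \<in> W" "y \<in> W" "z \<in> W" "x \<noteq> y" "x \<noteq> z" "y \<noteq> z" and U: "U = chm (card W - 3) p 1"
    and big: "3 * U < card {X \<in> G. x \<in> X \<and> y \<in> X \<and> z \<notin> X}"
      "3 * U < card {X \<in> G. x \<in> X \<and> z \<in> X \<and> y \<notin> X}"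
      "3 * U < card {X \<in> G. y \<in> X \<and> z \<in> X \<and> x \<notin> X}"
  shows "\<exists>v\<in>W. card {X \<in> G. v \<notin> X} \<le> (card W - 3) choose p"
proof -
  define D where "D = {x, y, z}"
  let ?C = "(card W - 3) choose p"
  define c where "c S = card {X \<in> G. X \<inter> D = S}" for S
  have D: "finite (W - D)" "card (W - D) = card W - 3" using W xyz by (simp_all add: D_def card_Diff_subset)
  have Pow: "G \<subseteq> Pow W" using G by auto
  have fG: "finite G" using finite_family[OF W(1) G(1)] .
  \<comment> \<open>This is the average of \<open>c {a, b} + 4 * c {d} \<le> ?C\<close> and
    \<open>c {a, b} + 4 * c {} \<le> ?C\<close>, from \<open>hit_witness_ratio\<close> with exponent
    1 and ratio 4.\<close>
  have pair: "c {a, b} + 2 * c {d} + 2 * c {} \<le> ?C"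
    if abd: "a \<noteq> b" "a \<noteq> d" "b \<noteq> d" "3 * U < c {a, b}" for a b d
  proof -
    have c: "c S = card (trace D S G)" for S by (simp add: c_def card_trace)
    have P: "trace D {a, b} G \<subseteq> ksets (W - D) p" using W(1) G(1) by (rule trace_ksets) (use abd in simp)
    have Q: "trace D {d} G \<subseteq> ksets (W - D) (Suc p)" using W(1) G(1) by (rule trace_ksets) simp
    have R: "trace D {} G \<subseteq> ksets (W - D) (Suc (Suc p))" using W(1) G(1) by (rule trace_ksets) simp
    have PQ: "cross 1 (trace D {a, b} G) (trace D {d} G)"
      by (rule cross_trace[OF W(1) Pow Pow G(2)]) (use abd in simp)
    have PR: "cross 1 (trace D {a, b} G) (trace D {} G)"
      by (rule cross_trace[OF W(1) Pow Pow G(2)]) simp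
    have "hit_witness (W - D) p (Suc p) 2 (trace D {a, b} G) (trace D {d} G)"
      by (rule cross_hit_witness[OF D(1) P Q PQ, of 1]) (use abd(4) D U c in auto)
    from hit_witness_ratio[OF D(1) this, of 1 4]
    have 1: "c {a, b} + 4 * c {d} \<le> ?C" using D W c by simp
    have "2 \<le> card W - 3" using W(2) by simp
    then have "chm (card W - 3 - 1) p 1 \<le> U" "chm (card W - 3 - 2) p 2 \<le> U"
      using U chm_mono[OF diff_le_self, of "card W - 3" 1 p 1] chm_2_le[of "card W - 3" p] by linarith+
    then have "2 * chm (card (W - D) - 1) p 1 + chm (card (W - D) - 2) p 2 < card (trace D {a, b} G)"
      using abd(4) D(2) c by simp
    then have "hit_witness (W - D) p (Suc (Suc p)) 3 (trace D {a, b} G) (trace D {} G)"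
      using cross_hit_witness_3[OF D(1) _ P R PR] D W by simp
    from hit_witness_ratio[OF D(1) this, of 1 4]
    have "c {a, b} + 4 * c {} \<le> ?C" using D W c by simp
    then show ?thesis using 1 by linarith
  qed
  have "{X \<in> G. x \<in> X \<and> y \<in> X \<and> z \<notin> X} = {X \<in> G. X \<inter> D = {x, y}}"
    "{X \<in> G. x \<in> X \<and> z \<in> X \<and> y \<notin> X} = {X \<in> G. X \<inter> D = {x, z}}"
    "{X \<in> G. y \<in> X \<and> z \<in> X \<and> x \<notin> X} = {X \<in> G. X \<inter> D = {y, z}}"
    using xyz by (auto simp: D_def)
  then have pairs: "c {x, y} + 2 * c {z} + 2 * c {} \<le> ?C" "c {x, z} + 2 * c {y} + 2 * c {} \<le> ?C"
    "c {y, z} + 2 * c {x} + 2 * c {} \<le> ?C"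
    using pair[of x y z] pair[of x z y] pair[of y z x] xyz big by (auto simp: c_def)
  have avoid: "card {X \<in> G. a \<notin> X} \<le> c {b, d} + c {b} + c {d} + c {}" if "D = {a, b, d}" for a b d
  proof -
    have "card {X \<in> G. a \<notin> X} \<le> card ({X \<in> G. X \<inter> D = {b, d}} \<union> {X \<in> G. X \<inter> D = {b}} \<union> {X \<in> G. X \<inter> D = {d}}) + c {}"
      unfolding c_def using fG that by (intro card_cover_le) auto
    also have "\<dots> \<le> card ({X \<in> G. X \<inter> D = {b, d}} \<union> {X \<in> G. X \<inter> D = {b}}) + c {d} + c {}"
      unfolding c_def by (intro add_mono card_Un_le) auto
    also have "\<dots> \<le> c {b, d} + c {b} + c {d} + c {}"
      unfolding c_def by (intro add_mono card_Un_le) auto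
    finally show ?thesis .
  qed
  have "card {X \<in> G. x \<notin> X} \<le> c {y, z} + c {y} + c {z} + c {}"
    "card {X \<in> G. y \<notin> X} \<le> c {x, z} + c {x} + c {z} + c {}"
    "card {X \<in> G. z \<notin> X} \<le> c {x, y} + c {x} + c {y} + c {}"
    by (rule avoid; auto simp: D_def)+
  \<comment> \<open>In the sum each pair occurs once, each singleton twice and the empty pattern
    three times; \<open>pairs\<close> supplies it six times.\<close>
  then have "card {X \<in> G. x \<notin> X} + card {X \<in> G. y \<notin> X} + card {X \<in> G. z \<notin> X} \<le> 3 * ?C"
    using pairs by linarith
  then have "card {X \<in> G. x \<notin> X} \<le> ?C \<or> card {X \<in> G. y \<notin> X} \<le> ?C \<or> card {X \<in> G. z \<notin> X} \<le> ?C" by linarith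
  then show ?thesis using xyz by blast
qed

theorem diversity_le:
  fixes W :: "nat set"
  assumes W: "finite W" "36 * (p + 2) < card W" and G: "G \<subseteq> ksets W (Suc (Suc p))" "cross 1 G G"
  shows "\<exists>v\<in>W. card {X \<in> G. v \<notin> X} \<le> (card W - 3) choose p"
proof (rule ccontr)
  assume no: "\<not> ?thesis"
  define U where "U = chm (card W - 3) p 1"
  have U: "35 * U < card {X \<in> G. v \<notin> X}" if "v \<in> W" for v
    using no that chm_le_binomial[OF W(2)] unfolding U_def by (meson le_less_trans not_le)
  have fG: "finite G" using finite_family[OF W(1) G(1)] .
  have Pow: "G \<subseteq> Pow W" using G by auto
  have heavy: "\<exists>w\<in>W. w \<noteq> v \<and> 8 * U < card {X \<in> G. w \<in> X \<and> v \<notin> X}" if v: "v \<in> W" for v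
  proof -
    have "\<exists>w\<in>W - {v}. 8 * U < card {X \<in> {X \<in> G. v \<notin> X}. w \<in> X}"
    proof (rule heavy_vertex)
      show "{X \<in> G. v \<notin> X} \<subseteq> ksets (W - {v}) (Suc (Suc p))" using G by auto
      show "cross 1 {X \<in> G. v \<notin> X} {X \<in> G. v \<notin> X}" using G(2) by (auto simp: cross_def)
      \<comment> \<open>Deleting \<open>v\<close> turns the parameter into
        \<open>card W - 3\<close>, the one defining \<open>U\<close>.\<close>
      show "chm (card (W - {v}) - 2) p 1 \<le> U" using v W by (simp add: U_def numeral_3_eq_3)
    qed (use W v U in auto)
    moreover have "{X \<in> {X \<in> G. v \<notin> X}. w \<in> X} = {X \<in> G. w \<in> X \<and> v \<notin> X}" for w by auto
    ultimately show ?thesis by auto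
  qed
  have centre: "\<exists>y\<in>W - {u, v}. card {X \<in> G. u \<in> X \<and> v \<notin> X \<and> y \<notin> X} \<le> U \<and>
      card {X \<in> G. v \<in> X \<and> u \<notin> X \<and> y \<notin> X} \<le> U"
    if uv: "u \<in> W" "v \<in> W" "u \<noteq> v" and b: "3 * U < card {X \<in> G. u \<in> X \<and> v \<notin> X}" "3 * U < card {X \<in> G. v \<in> X \<and> u \<notin> X}"
    for u v
  proof -
    let ?D = "{u, v}"
    have c: "card (W - ?D) = card W - 2" using uv W by (simp add: card_Diff_subset)
    have s: "{X \<in> G'. u \<in> X \<and> v \<notin> X} = {X \<in> G'. X \<inter> ?D = {u}}" "{X \<in> G'. v \<in> X \<and> u \<notin> X} = {X \<in> G'. X \<inter> ?D = {v}}"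
      for G' using uv by auto
    have PQ: "trace ?D {u} G \<subseteq> ksets (W - ?D) (Suc p)" "trace ?D {v} G \<subseteq> ksets (W - ?D) (Suc p)"
      by (rule trace_ksets[OF W(1) G(1)], simp)+
    have cr: "cross 1 (trace ?D {u} G) (trace ?D {v} G)"
      by (rule cross_trace[OF W(1) Pow Pow G(2)]) (use uv in simp)
    have "chm (Suc (card W - 3)) p 1 \<le> 2 * U" unfolding U_def using W(2) by (intro chm_Suc_le_double) simp
    moreover have "Suc (card W - 3) = card W - 2" using W(2) by simp
    ultimately have U': "chm (card (W - ?D) - 1) p 1 \<le> U" "chm (card (W - ?D)) p 1 \<le> 2 * U"
      using c by (simp_all add: U_def)
    have b': "2 * U < card (trace ?D {u} G)" "3 * U < card (trace ?D {v} G)"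
      using b unfolding s card_trace by auto
    obtain y where y: "y \<in> W - ?D" "card {X \<in> trace ?D {u} G. y \<notin> X} \<le> U" "card {X \<in> trace ?D {v} G. y \<notin> X} \<le> U"
      using common_centre[OF _ PQ cr U' b'] W(1) by auto
    have "{X \<in> G. u \<in> X \<and> v \<notin> X \<and> y \<notin> X} = {X \<in> {X \<in> G. y \<notin> X}. u \<in> X \<and> v \<notin> X}"
      "{X \<in> G. v \<in> X \<and> u \<notin> X \<and> y \<notin> X} = {X \<in> {X \<in> G. y \<notin> X}. v \<in> X \<and> u \<notin> X}" by blast+
    then have "card {X \<in> G. u \<in> X \<and> v \<notin> X \<and> y \<notin> X} \<le> U" "card {X \<in> G. v \<in> X \<and> u \<notin> X \<and> y \<notin> X} \<le> U"
      using y trace_avoid[of y ?D "{u}" G] trace_avoid[of y ?D "{v}" G] by (simp_all only: s card_trace Diff_iff simp_thms)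
    then show ?thesis using y(1) by blast
  qed
  have triple: "card {X \<in> G. a \<in> X \<and> b \<in> X \<and> c \<in> X} \<le> U"
    if "a \<in> W" "b \<in> W" "c \<in> W" "a \<noteq> b" "a \<noteq> c" "b \<noteq> c" for a b c
    unfolding U_def by (rule card_triple_le[OF W(1) G(1) that])
  let ?d = "\<lambda>v. card {X \<in> G. v \<in> X}"
  have "W \<noteq> {}" using W by auto
  then have "Max (?d ` W) \<in> ?d ` W" using W(1) by (intro Max_in) auto
  then obtain a where "a \<in> W" "?d a = Max (?d ` W)" by force
  then have a: "a \<in> W" "\<And>v. v \<in> W \<Longrightarrow> ?d v \<le> ?d a" using W(1) by (simp_all add: Max_ge)
  obtain b where b: "b \<in> W" "b \<noteq> a" "8 * U < card {X \<in> G. b \<in> X \<and> a \<notin> X}" using heavy[OF a(1)] by blast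
  have deg: "?d u = card {X \<in> G. u \<in> X \<and> v \<notin> X} + card {X \<in> G. u \<in> X \<and> v \<in> X}" for u v
  proof -
    have "{X \<in> {X \<in> G. u \<in> X}. v \<in> X} = {X \<in> G. u \<in> X \<and> v \<in> X}"
      "{X \<in> {X \<in> G. u \<in> X}. v \<notin> X} = {X \<in> G. u \<in> X \<and> v \<notin> X}" by auto
    then show ?thesis using card_degree_split[of "{X \<in> G. u \<in> X}" v] fG by simp
  qed
  have comm: "{X \<in> G. b \<in> X \<and> a \<in> X} = {X \<in> G. a \<in> X \<and> b \<in> X}" by auto
  \<comment> \<open>By maximality of the degree of \<open>a\<close>, at least as many members
    contain \<open>a\<close> without \<open>b\<close> as \<open>b\<close> without
    \<open>a\<close>.\<close>
  have ab: "8 * U < card {X \<in> G. a \<in> X \<and> b \<notin> X}"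
    using a(2)[OF b(1)] deg[of a b] deg[of b a] b(3) unfolding comm by linarith
  obtain c where c: "c \<in> W" "c \<noteq> a" "c \<noteq> b" "card {X \<in> G. a \<in> X \<and> b \<notin> X \<and> c \<notin> X} \<le> U"
      "card {X \<in> G. b \<in> X \<and> a \<notin> X \<and> c \<notin> X} \<le> U"
    using centre[OF a(1) b(1) b(2)[symmetric]] ab b(3) by auto
  have "card {X \<in> G. a \<in> X \<and> b \<notin> X} \<le> card {X \<in> G. a \<in> X \<and> c \<in> X \<and> b \<notin> X} + card {X \<in> G. a \<in> X \<and> b \<notin> X \<and> c \<notin> X}"
    using fG by (intro card_cover_le) auto
  then have ac: "7 * U < card {X \<in> G. a \<in> X \<and> c \<in> X \<and> b \<notin> X}" using ab c(4) by linarith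
  have "card {X \<in> G. b \<in> X \<and> a \<notin> X} \<le> card {X \<in> G. b \<in> X \<and> c \<in> X \<and> a \<notin> X} + card {X \<in> G. b \<in> X \<and> a \<notin> X \<and> c \<notin> X}"
    using fG by (intro card_cover_le) auto
  then have bc: "7 * U < card {X \<in> G. b \<in> X \<and> c \<in> X \<and> a \<notin> X}" using b(3) c(5) by linarith
  \<comment> \<open>Otherwise \<open>a\<close>, \<open>b\<close>, \<open>c\<close> would be a
    triangle of heavy pairs.\<close>
  have small: "card {X \<in> G. a \<in> X \<and> b \<in> X \<and> c \<notin> X} \<le> 3 * U"
  proof (rule ccontr)
    assume "\<not> ?thesis"
    then show False
      using triangle_diversity[OF W G a(1) b(1) c(1) _ _ _ U_def] b(2) c(2,3) ac bc no by simp
  qed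
  obtain d where d: "d \<in> W" "d \<noteq> c" "8 * U < card {X \<in> G. d \<in> X \<and> c \<notin> X}" using heavy[OF c(1)] by blast
  have "card {X \<in> G. a \<in> X \<and> c \<notin> X} \<le> card {X \<in> G. a \<in> X \<and> b \<in> X \<and> c \<notin> X} + card {X \<in> G. a \<in> X \<and> b \<notin> X \<and> c \<notin> X}"
    using fG by (intro card_cover_le) auto
  \<comment> \<open>At most \<open>3 * U + U\<close> members contain \<open>a\<close> and avoid
    \<open>c\<close>, fewer than contain \<open>d\<close> and avoid \<open>c\<close>.\<close>
  then have "d \<noteq> a" using d(3) small c(4) by auto
  have "card {X \<in> G. b \<in> X \<and> c \<notin> X} \<le> card {X \<in> G. a \<in> X \<and> b \<in> X \<and> c \<notin> X} + card {X \<in> G. b \<in> X \<and> a \<notin> X \<and> c \<notin> X}"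
    using fG by (intro card_cover_le) auto
  then have "d \<noteq> b" using d(3) small c(5) by auto
  have "card {X \<in> G. a \<in> X \<and> c \<in> X \<and> b \<notin> X} \<le> card {X \<in> G. a \<in> X \<and> c \<in> X \<and> d \<in> X} + card {X \<in> G. c \<in> X \<and> d \<notin> X}"
    using fG by (intro card_cover_le) auto
  moreover have acd: "card {X \<in> G. a \<in> X \<and> c \<in> X \<and> d \<in> X} \<le> U"
    using triple[OF a(1) c(1) d(1)] c(2) d(2) \<open>d \<noteq> a\<close> by simp
  ultimately have cd: "3 * U < card {X \<in> G. c \<in> X \<and> d \<notin> X}" using ac by linarith
  obtain y where y: "y \<in> W" "y \<noteq> c" "y \<noteq> d" "card {X \<in> G. c \<in> X \<and> d \<notin> X \<and> y \<notin> X} \<le> U"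
    using centre[OF c(1) d(1) d(2)[symmetric] cd] d(3) by auto
  \<comment> \<open>The centre \<open>y\<close> cannot account for both \<open>ac\<close> and
    \<open>bc\<close>: members through \<open>c\<close> that avoid \<open>d\<close> nearly all
    contain \<open>y\<close>, while triples lie in at most \<open>U\<close> members. If
    \<open>y = a\<close>, few members contain \<open>b\<close> and \<open>c\<close> but not
    \<open>a\<close>; otherwise few contain \<open>a\<close> and \<open>c\<close> but not
    \<open>b\<close>.\<close>
  show False
  proof (cases "y = a")
    case True
    have "card {X \<in> G. b \<in> X \<and> c \<in> X \<and> a \<notin> X} \<le> card {X \<in> G. b \<in> X \<and> c \<in> X \<and> d \<in> X} + card {X \<in> G. c \<in> X \<and> d \<notin> X \<and> y \<notin> X}"
      using fG True by (intro card_cover_le) auto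
    moreover have "card {X \<in> G. b \<in> X \<and> c \<in> X \<and> d \<in> X} \<le> U"
      using triple[OF b(1) c(1) d(1)] c(3) d(2) \<open>d \<noteq> b\<close> by simp
    ultimately show ?thesis using bc y(4) by linarith
  next
    case False
    have "card {X \<in> G. a \<in> X \<and> c \<in> X \<and> b \<notin> X} \<le>
        card ({X \<in> G. a \<in> X \<and> c \<in> X \<and> d \<in> X} \<union> {X \<in> G. a \<in> X \<and> c \<in> X \<and> y \<in> X}) + card {X \<in> G. c \<in> X \<and> d \<notin> X \<and> y \<notin> X}"
      using fG by (intro card_cover_le) auto
    moreover have "card ({X \<in> G. a \<in> X \<and> c \<in> X \<and> d \<in> X} \<union> {X \<in> G. a \<in> X \<and> c \<in> X \<and> y \<in> X}) \<le> U + U"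
      using acd triple[OF a(1) c(1) y(1)] c(2) y(2) False by (intro order.trans[OF card_Un_le] add_mono) auto
    ultimately show ?thesis using ac y(4) by linarith
  qed
qed

section \<open>Large sets\<close>

lemma geometric_sum_le:
  fixes L :: "nat \<Rightarrow> nat"
  assumes "\<And>t. 2 \<le> t \<Longrightarrow> t \<le> Suc m \<Longrightarrow> 20 ^ (t - 1) * L t \<le> K"
  shows "19 * (\<Sum>t=2..Suc m. L t) \<le> K"
proof -
  \<comment> \<open>The summand \<open>K\<close> on the left records that the geometric sum is
    \<open>(20 ^ m - 1) / 19\<close>; the induction needs this exact form.\<close>
  have "19 * 20 ^ m * (\<Sum>t=2..Suc m. L t) + K \<le> K * 20 ^ m"
    using assms
  proof (induction m)
    case (Suc m)
    define A where "A = 19 * 20 ^ m * (\<Sum>t=2..Suc m. L t)"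
    define B where "B = 20 ^ Suc m * L (Suc (Suc m))"
    have IH: "A + K \<le> K * 20 ^ m" unfolding A_def using Suc by simp
    have "B \<le> K" unfolding B_def using Suc.prems[of "Suc (Suc m)"] by simp
    then have "20 * A + 19 * B + K \<le> 20 * (K * 20 ^ m)" using IH by linarith
    moreover have "19 * 20 ^ Suc m * (\<Sum>t=2..Suc (Suc m). L t) = 20 * A + 19 * B"
      by (simp add: A_def B_def algebra_simps)
    moreover have "K * 20 ^ Suc m = 20 * (K * 20 ^ m)" by simp
    ultimately show ?case by presburger
  qed simp
  moreover have "20 ^ m * (19 * (\<Sum>t=2..Suc m. L t)) = 19 * 20 ^ m * (\<Sum>t=2..Suc m. L t)"
    "20 ^ m * K = K * 20 ^ m" by (simp_all only: ac_simps)
  ultimately have "20 ^ m * (19 * (\<Sum>t=2..Suc m. L t)) \<le> 20 ^ m * K" by linarith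
  then show ?thesis by (rule mult_left_le_imp_le) simp
qed

lemma card_sum_fibres:
  assumes "finite T" "finite I" "g ` T \<subseteq> I"
  shows "card T = (\<Sum>y\<in>I. card {x \<in> T. g x = y})"
  using sum.group[OF assms, of "\<lambda>_. 1::nat"] by simp

text \<open>Let \<open>u\<close>, \<open>v\<close>, \<open>w\<close> be the three smallest elements
  and \<open>P\<close> the link of all three in the lowest level \<open>Lv 1\<close>. If
  \<open>P\<close> is small, every level is a small multiple of \<open>U\<close>. If
  \<open>P\<close> is large, it forces all other traces to high walks, and the deficit of
  \<open>P\<close> from the bound pays for them.\<close>

lemma shifted_large_sets_le:
  fixes W :: "nat set"
  assumes W: "finite W" "36 * (p + 2) < card W" and T: "T \<subseteq> Pow W" "shifted W T"
    and sz: "\<And>X. X \<in> T \<Longrightarrow> p + 3 \<le> card X"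
    and int: "\<And>X Y. X \<in> T \<Longrightarrow> Y \<in> T \<Longrightarrow> card X + card Y \<le> card (X \<inter> Y) + (2 * p + 3)"
  shows "card T \<le> (card W - 3) choose p"
proof -
  let ?n = "card W" and ?C = "(card W - 3) choose p"
  define U where "U = chm (?n - 3) p 1"
  have UC: "35 * U \<le> ?C" unfolding U_def by (rule chm_le_binomial[OF W(2)])
  have fT: "finite T" using T W by (meson finite_Pow_iff finite_subset)
  define Lv where "Lv t = {X \<in> T. card X - (p + 2) = t}" for t
  have Lv: "Lv t \<subseteq> ksets W (p + 2 + t)" for t using T sz by (force simp: Lv_def)
  have LvT: "Lv t \<subseteq> T" for t by (auto simp: Lv_def)
  have LvPow: "Lv t \<subseteq> Pow W" for t using LvT T by blast
  have fLv: "finite (Lv t)" for t using fT LvT finite_subset by blast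
  have card_Lv: "card X = p + 2 + t" if "X \<in> Lv t" for X t using that Lv by blast
  have "card X \<le> 2 * p + 3" if "X \<in> T" for X using int[OF that that] by simp
  then have "(\<lambda>X. card X - (p + 2)) ` T \<subseteq> {1..Suc p}" using sz by fastforce
  then have "card T = (\<Sum>t\<in>{1..Suc p}. card (Lv t))"
    unfolding Lv_def by (intro card_sum_fibres[OF fT]) auto
  also have "{1..Suc p} = insert 1 {2..Suc p}" by auto
  finally have cT: "card T = card (Lv 1) + (\<Sum>t=2..Suc p. card (Lv t))" by simp
  have cross_Lv: "cross (s + t + 1) (Lv s) (Lv t)" for s t
    unfolding cross_def
  proof (intro ballI)
    fix X Y assume XY: "X \<in> Lv s" "Y \<in> Lv t"
    have "card X + card Y \<le> card (X \<inter> Y) + (2 * p + 3)" using XY LvT by (intro int) auto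
    then show "s + t + 1 \<le> card (X \<inter> Y)" using card_Lv[OF XY(1)] card_Lv[OF XY(2)] by linarith
  qed
  have sh: "shifted W (Lv t)" for t
    unfolding shifted_def
  proof (intro ballI impI)
    fix X j i assume X: "X \<in> Lv t" "j \<in> X \<inter> W" "i \<in> W" "i < j" "i \<notin> X"
    have "finite X" using X(1) LvPow W finite_subset by blast
    then have "card (insert i (X - {j})) = card X" using X(2,5) card_Suc_Diff1[of X j] by simp
    moreover have "insert i (X - {j}) \<in> T" using T(2) X LvT unfolding shifted_def by blast
    ultimately show "insert i (X - {j}) \<in> Lv t" using X(1) by (simp add: Lv_def)
  qed
  \<comment> \<open>The level \<open>Lv t\<close> is \<open>2 * t + 1\<close>-intersecting; pairing
    a member with itself excludes missing \<open>2 * t + 1\<close>.\<close>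
  have h: "hits W X (2 * t + 1)" if "X \<in> Lv t" for X t
    using shifted_cross_hits[OF W(1) LvPow LvPow sh cross_Lv _ that that, of "2 * t + 2" "2 * t + 1"]
      hits_mono[of W X "2 * t + 2" "2 * t + 1"] by fastforce
  have "W \<noteq> {}" using W by auto
  then obtain u where u: "u \<in> W" "\<And>x. x \<in> W \<Longrightarrow> u \<le> x" using first_element[OF W(1)] by blast
  define W1 where "W1 = W - {u}"
  have W1: "finite W1" "card W1 = ?n - 1" using W u(1) by (auto simp: W1_def)
  then have "W1 \<noteq> {}" using W(2) by fastforce
  then obtain v where v: "v \<in> W1" "\<And>x. x \<in> W1 \<Longrightarrow> v \<le> x" using first_element[OF W1(1)] by blast
  define W2 where "W2 = W1 - {v}"
  have W2: "finite W2" "card W2 = ?n - 2" using W1 v(1) by (auto simp: W2_def)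
  then have "W2 \<noteq> {}" using W(2) by fastforce
  then obtain w where w: "w \<in> W2" "\<And>x. x \<in> W2 \<Longrightarrow> w \<le> x" using first_element[OF W2(1)] by blast
  define W3 where "W3 = W2 - {w}"
  have W3: "finite W3" "card W3 = ?n - 3" using W2 w(1) by (auto simp: W3_def)
  define D where "D = {u, v, w}"
  have D: "finite D" "card D = 3" "W - D = W3" using v(1) w(1) by (auto simp: D_def W1_def W2_def W3_def)
  define P where "P = trace D D (Lv 1)"
  show ?thesis
  proof (cases "card P \<le> U")
    case True
    let ?F1 = "{X. X \<subseteq> W1 \<and> card X = p + 3 \<and> hits W1 X 4}"
    let ?F2 = "{X. X \<subseteq> W2 \<and> card X = p + 2 \<and> hits W2 X 3}"
    let ?F3 = "{X. X \<subseteq> W3 \<and> card X = p + 1 \<and> hits W3 X 2}"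
    have fin: "finite ?F1" "finite ?F2" "finite ?F3"
      using W1 W2 W3 by (simp_all add: finite_subset[OF _ finite_ksets])
    have "Lv 1 \<subseteq> ({X \<in> Lv 1. X \<inter> D = D} \<union> ?F1) \<union> (insert u ` ?F2 \<union> (insert u \<circ> insert v) ` ?F3)"
    proof
      fix X assume XL: "X \<in> Lv 1"
      then have X: "X \<subseteq> W" "card X = p + 3" using Lv[of 1] by auto
      have fX: "finite X" using X W finite_subset by blast
      have hX: "hits W X 3" using h[OF XL] by (simp add: numeral_3_eq_3 numeral_2_eq_2)
      consider "u \<notin> X" | "u \<in> X" "v \<notin> X" | "u \<in> X" "v \<in> X" "w \<notin> X" | "D \<subseteq> X"
        by (auto simp: D_def)
      then show "X \<in> ({X \<in> Lv 1. X \<inter> D = D} \<union> ?F1) \<union> (insert u ` ?F2 \<union> (insert u \<circ> insert v) ` ?F3)"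
      proof cases
        case 1
        have "hits W1 X 4" unfolding W1_def
          using hits_Min_notin[OF W(1) X(1) u(1) 1 u(2) hX] by (simp add: eval_nat_numeral)
        then show ?thesis using X 1 by (auto simp: W1_def)
      next
        case 2
        have X1: "X - {u} \<subseteq> W1" using X by (auto simp: W1_def)
        have "hits W1 (X - {u}) 2" unfolding W1_def
          using hits_Min_in[OF W(1) X(1) 2(1) u(2)] hX by (simp add: eval_nat_numeral)
        then have "hits W2 (X - {u}) 3" unfolding W2_def
          using hits_Min_notin[OF W1(1) X1 v(1) _ v(2)] 2(2) by (simp add: eval_nat_numeral)
        moreover have "X - {u} \<subseteq> W2" "card (X - {u}) = p + 2" using X1 2 X(2) fX by (auto simp: W2_def)
        ultimately have "X - {u} \<in> ?F2" by simp
        moreover have "X = insert u (X - {u})" using 2 by auto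
        ultimately have "X \<in> insert u ` ?F2" by (rule rev_image_eqI)
        then show ?thesis by blast
      next
        case 3
        have uv: "u \<noteq> v" using v(1) by (auto simp: W1_def)
        have X1: "X - {u} \<subseteq> W1" using X by (auto simp: W1_def)
        have h1: "hits W1 (X - {u}) 2" unfolding W1_def
          using hits_Min_in[OF W(1) X(1) 3(1) u(2)] hX by (simp add: eval_nat_numeral)
        have X2: "X - {u} - {v} \<subseteq> W2" using X1 by (auto simp: W2_def)
        have "v \<in> X - {u}" using 3 uv by simp
        then have "hits W2 (X - {u} - {v}) 1" unfolding W2_def
          using hits_Min_in[OF W1(1) X1 _ v(2)] h1 by (simp add: eval_nat_numeral)
        then have "hits W3 (X - {u} - {v}) 2" unfolding W3_def
          using hits_Min_notin[OF W2(1) X2 w(1) _ w(2)] 3(3) by (simp add: eval_nat_numeral)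
        moreover have "X - {u} - {v} \<subseteq> W3" using X2 3 by (auto simp: W3_def)
        moreover have "card (X - {u} - {v}) = p + 1" using 3 uv X(2) fX by simp
        ultimately have "X - {u} - {v} \<in> ?F3" by simp
        moreover have "X = (insert u \<circ> insert v) (X - {u} - {v})" using 3 by auto
        ultimately have "X \<in> (insert u \<circ> insert v) ` ?F3" by (rule rev_image_eqI)
        then show ?thesis by blast
      next
        case 4 then show ?thesis using XL by blast
      qed
    qed
    then have "card (Lv 1) \<le> card ({X \<in> Lv 1. X \<inter> D = D} \<union> ?F1) + card (insert u ` ?F2 \<union> (insert u \<circ> insert v) ` ?F3)"
      by (rule card_cover_le) (use fin fLv in simp_all)
    also have "\<dots> \<le> (card P + card ?F1) + (card ?F2 + card ?F3)"
      unfolding P_def card_trace using fin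
      by (intro add_mono order.trans[OF card_Un_le] card_image_le order.refl) auto
    \<comment> \<open>Each extra element of the ground set at most doubles the binomial:
      \<open>W1\<close>, \<open>W2\<close>, \<open>W3\<close> have two, one and no elements beyond
      \<open>card W - 3\<close>.\<close>
    also have "\<dots> \<le> (U + 4 * U) + (2 * U + U)"
    proof (intro add_mono)
      have s: "?n - 1 = Suc (Suc (?n - 3))" "?n - 2 = Suc (?n - 3)" using W(2) by auto
      have d1: "chm (Suc (?n - 3)) p 1 \<le> 2 * U" unfolding U_def using W(2) by (intro chm_Suc_le_double) simp
      have d2: "chm (Suc (Suc (?n - 3))) p 1 \<le> 2 * chm (Suc (?n - 3)) p 1"
        using W(2) by (intro chm_Suc_le_double) simp
      have e: "chm m (p + 3) 4 = chm m p 1" "chm m (p + 2) 3 = chm m p 1" "chm m (p + 1) 2 = chm m p 1" for m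
        by (auto simp: chm_def)
      show "card ?F1 \<le> 4 * U" using card_hits_le[OF W1(1), of "p + 3" 4] W1 s e d1 d2 by simp
      show "card ?F2 \<le> 2 * U" using card_hits_le[OF W2(1), of "p + 2" 3] W2 s e d1 by simp
      show "card ?F3 \<le> U" using card_hits_le[OF W3(1), of "p + 1" 2] W3 e by (simp add: U_def)
    qed (use True in simp)
    finally have L1: "card (Lv 1) \<le> 8 * U" by simp
    \<comment> \<open>A factor 20 for every level above the second, then \<open>8 * U\<close> for
      three doublings and one further factor 20. The total is at most
      \<open>8 * U + (160 / 19) * U\<close>, below \<open>35 * U\<close>.\<close>
    have "20 ^ (t - 1) * card (Lv t) \<le> 160 * U" if t: "2 \<le> t" "t \<le> Suc p" for t
    proof -
      have "card (Lv t) \<le> chm ?n (p + 2 + t) (2 * t + 1)"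
        using h Lv by (intro card_hits_subset[OF W(1)]) blast
      also have "\<dots> = ?n choose (Suc p - t)" using t by (simp add: chm_def)
      finally have "20 ^ (t - 2) * card (Lv t) \<le> 20 ^ (t - 2) * (?n choose (Suc p - t))" by simp
      also have "\<dots> \<le> ?n choose (Suc p - t + (t - 2))"
        by (rule binomial_ratio_power) (use W(2) t in simp)
      also have "Suc p - t + (t - 2) = p - 1" using t by simp
      also have "?n choose (p - 1) = chm ?n p 1" using t by (simp add: chm_def)
      also have "\<dots> \<le> 8 * U"
      proof -
        have s: "?n = Suc (Suc (Suc (?n - 3)))" using W(2) by auto
        have "chm (Suc (?n - 3)) p 1 \<le> 2 * U" unfolding U_def using W(2) by (intro chm_Suc_le_double) simp
        moreover have "chm (Suc (Suc (?n - 3))) p 1 \<le> 2 * chm (Suc (?n - 3)) p 1"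
          using W(2) by (intro chm_Suc_le_double) simp
        moreover have "chm (Suc (Suc (Suc (?n - 3)))) p 1 \<le> 2 * chm (Suc (Suc (?n - 3))) p 1"
          using W(2) by (intro chm_Suc_le_double) simp
        moreover have "chm ?n p 1 = chm (Suc (Suc (Suc (?n - 3)))) p 1"
          by (rule arg_cong[OF s, of "\<lambda>m. chm m p 1"])
        ultimately show ?thesis by linarith
      qed
      finally have "20 ^ (t - 2) * card (Lv t) \<le> 8 * U" .
      moreover have "(20::nat) ^ (t - 1) = 20 * 20 ^ (t - 2)"
        using t by (metis Suc_1 Suc_diff_Suc Suc_le_eq power_Suc)
      then have "20 ^ (t - 1) * card (Lv t) = 20 * (20 ^ (t - 2) * card (Lv t))" by simp
      ultimately show ?thesis by linarith
    qed
    then have "19 * (\<Sum>t=2..Suc p. card (Lv t)) \<le> 160 * U" by (rule geometric_sum_le)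
    then show ?thesis using cT L1 UC by linarith
  next
    case False
    have PQ: "P \<subseteq> ksets W3 p"
    proof -
      have "P \<subseteq> ksets (W - D) p" unfolding P_def
        by (rule trace_ksets[OF W(1) Lv]) (use D in simp)
      then show ?thesis using D by simp
    qed
    \<comment> \<open>\<open>P\<close> and this trace are cross \<open>t'\<close>-intersecting for
      \<open>t' = t + 2 - card S\<close>. More than \<open>U\<close> sets in \<open>P\<close> force
      level \<open>2 * t'\<close> on \<open>p + t'\<close>-sets, so the exponent in the ratio bound
      is \<open>t'\<close>.\<close>
    have cl: "card P + 20 ^ (t + 2 - card S) * card (trace D S (Lv t)) \<le> ?C"
      if t: "1 \<le> t" "t \<le> Suc p" and S: "S \<subseteq> D" "card S < t + 2" for t S
    proof -
      define t' where "t' = t + 2 - card S"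
      have t': "t + 2 = t' + card S" "0 < t'" using S by (auto simp: t'_def)
      have Q: "trace D S (Lv t) \<subseteq> ksets W3 (p + t')"
      proof -
        have "trace D S (Lv t) \<subseteq> ksets (W - D) (p + t')"
          by (rule trace_ksets[OF W(1) Lv]) (use t' in simp)
        then show ?thesis using D by simp
      qed
      have "D \<inter> S = S" using S by blast
      then have cr: "cross t' P (trace D S (Lv t))" unfolding P_def
        by (intro cross_trace[OF W(1) LvPow LvPow cross_Lv]) (use t' in simp)
      have "hit_witness W3 p (p + t') (2 * t') P (trace D S (Lv t))"
        by (rule cross_hit_witness[OF W3(1) PQ Q cr t'(2), of 1]) (use False W3 U_def in auto)
      from hit_witness_ratio[OF W3(1) this, of t' 20] show ?thesis
        using t' t W(2) W3(2) unfolding t'_def[symmetric] by simp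
    qed
    define E where "E = ?C - card P"
    have "card P \<le> ?C" using card_family_le[OF W3(1) PQ] W3(2) by simp
    then have PE: "card P + E = ?C" by (simp add: E_def)
    have split: "card (Lv t) = (\<Sum>S\<in>Pow D. card (trace D S (Lv t)))" for t
      unfolding card_trace using D by (intro card_sum_fibres[OF fLv]) auto
    have cS: "card S \<le> 3" if "S \<subseteq> D" for S using card_mono[OF D(1) that] D(2) by simp
    \<comment> \<open>The seven patterns other than \<open>D\<close> have exponent at least 1. In
      the levels \<open>t \<ge> 2\<close> all eight patterns have exponent at least
      \<open>t - 1\<close>, and \<open>7 / 20 + 8 / 19 < 1\<close>.\<close>
    have "20 * (card (Lv 1) - card P) \<le> 7 * E"
    proof -
      have "Pow D = insert D (Pow D - {D})" by blast
      then have "card (Lv 1) = card P + (\<Sum>S\<in>Pow D - {D}. card (trace D S (Lv 1)))"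
        unfolding split P_def using D(1) by (subst sum.remove[of "Pow D" D]) auto
      moreover have "20 * (\<Sum>S\<in>Pow D - {D}. card (trace D S (Lv 1))) \<le> card (Pow D - {D}) * E"
        unfolding sum_distrib_left
      proof (rule sum_bounded_above[THEN order.trans, of _ _ E])
        fix S assume S: "S \<in> Pow D - {D}"
        then have "S \<subset> D" by auto
        then have cS2: "card S < 3" using psubset_card_mono[OF D(1)] D(2) by metis
        then have "card P + 20 ^ (1 + 2 - card S) * card (trace D S (Lv 1)) \<le> ?C"
          using S by (intro cl) auto
        moreover have "(20::nat) ^ 1 \<le> 20 ^ (1 + 2 - card S)" using cS2 by (intro power_increasing) auto
        then have "20 * card (trace D S (Lv 1)) \<le> 20 ^ (1 + 2 - card S) * card (trace D S (Lv 1))"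
          by (intro mult_le_mono1) simp
        ultimately show "20 * card (trace D S (Lv 1)) \<le> E" using PE by linarith
      qed simp
      moreover have "card (Pow D - {D}) = 7" using D by (simp add: card_Pow)
      ultimately show ?thesis by simp
    qed
    moreover have "19 * (\<Sum>t=2..Suc p. card (Lv t)) \<le> 8 * E"
    proof (rule geometric_sum_le)
      fix t assume t: "2 \<le> t" "t \<le> Suc p"
      have "20 ^ (t - 1) * card (Lv t) \<le> card (Pow D) * E"
        unfolding split sum_distrib_left
      proof (rule sum_bounded_above[THEN order.trans, of _ _ E])
        fix S assume S: "S \<in> Pow D"
        then have c: "card S \<le> 3" using cS by simp
        then have "card P + 20 ^ (t + 2 - card S) * card (trace D S (Lv t)) \<le> ?C"
          using S t by (intro cl) auto
        moreover have "(20::nat) ^ (t - 1) \<le> 20 ^ (t + 2 - card S)" using c t by (intro power_increasing) auto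
        then have "20 ^ (t - 1) * card (trace D S (Lv t)) \<le> 20 ^ (t + 2 - card S) * card (trace D S (Lv t))"
          by (rule mult_le_mono1)
        ultimately show "20 ^ (t - 1) * card (trace D S (Lv t)) \<le> E" using PE by linarith
      qed simp
      then show "20 ^ (t - 1) * card (Lv t) \<le> 8 * E" using D by (simp add: card_Pow)
    qed
    ultimately show ?thesis using cT PE by linarith
  qed
qed

text \<open>The union bound is restated as a lower bound on intersections depending on the two
  sizes, the form that \<open>cross_shift_sizes\<close> preserves.\<close>

lemma large_sets_le:
  fixes W :: "nat set"
  assumes W: "finite W" "36 * (p + 2) < card W" and T: "T \<subseteq> Pow W"
    and sz: "\<And>X. X \<in> T \<Longrightarrow> p + 3 \<le> card X"
    and un: "\<And>X Y. X \<in> T \<Longrightarrow> Y \<in> T \<Longrightarrow> card (X \<union> Y) \<le> 2 * p + 3"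
  shows "card T \<le> (card W - 3) choose p"
proof -
  define I where "I A B \<longleftrightarrow> card A = card T \<and> (\<forall>X\<in>A. p + 3 \<le> card X) \<and>
    (\<forall>X\<in>A. \<forall>Y\<in>A. card X + card Y - (2 * p + 3) \<le> card (X \<inter> Y))" for A B :: "nat set set"
  have fin: "finite X" if "X \<in> A" "A \<subseteq> Pow W" for X A using that W finite_subset by blast
  have "\<exists>P' Q'. P' \<subseteq> Pow W \<and> Q' \<subseteq> Pow W \<and> I P' Q' \<and> shifted W P' \<and> shifted W Q'"
  proof (rule shift_to_shifted)
    have "card X + card Y - (2 * p + 3) \<le> card (X \<inter> Y)" if "X \<in> T" "Y \<in> T" for X Y
      using card_Un_Int[of X Y] un[OF that] fin[OF that(1) T] fin[OF that(2) T] by linarith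
    then show "I T {}" using sz by (simp add: I_def)
    fix P Q :: "nat set set" and i j :: nat assume I: "I P Q" and P: "P \<subseteq> Pow W" and "i < j"
    have "p + 3 \<le> card X" if "X \<in> shift i j P" for X
      using that I fin[OF _ P] by (auto simp: shift_def card_move I_def)
    moreover have "card X + card Y - (2 * p + 3) \<le> card (X \<inter> Y)" if "X \<in> shift i j P" "Y \<in> shift i j P" for X Y
      using cross_shift_sizes[of P P i j "\<lambda>a b. a + b - (2 * p + 3)", OF _ _ _ _ that] fin[OF _ P] I \<open>i < j\<close>
      by (auto simp: I_def)
    ultimately show "I (shift i j P) (shift i j Q)" using I by (auto simp: I_def card_shift)
  qed (use W T in auto)
  then obtain P Q where P: "P \<subseteq> Pow W" "I P Q" "shifted W P" by blast
  have "card P \<le> (card W - 3) choose p"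
  proof (rule shifted_large_sets_le[OF W P(1,3)])
    show "p + 3 \<le> card X" if "X \<in> P" for X using P(2) that by (simp add: I_def)
    show "card X + card Y \<le> card (X \<inter> Y) + (2 * p + 3)" if "X \<in> P" "Y \<in> P" for X Y
      using P(2) that unfolding I_def by (metis le_diff_conv)
  qed
  then show ?thesis using P(2) by (simp add: I_def)
qed

section \<open>Combining the large members with the diversity bound\<close>

theorem theorem1p8:
  fixes n d :: nat and \<F> :: "nat set set"
  assumes "n \<ge> 1" and "d \<ge> 1"
    and "n > 36 * (d + 1)"
    and "\<F> \<subseteq> Pow {1..n}"
    and "union_family (2 * d + 1) \<F>"
  shows "overflow n d \<F> \<le> 2 * ((n - 3) choose (d - 1))"
proof -
  \<comment> \<open>With this \<open>p\<close> the critical size \<open>d + 1\<close> is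
    \<open>p + 2\<close> and the bound \<open>2 * d + 1\<close> is \<open>2 * p + 3\<close>.\<close>
  obtain p where d: "d = Suc p" using assms(2) by (cases d) auto
  let ?W = "{1..n}" and ?C = "(n - 3) choose p"
  have W: "finite ?W" "36 * (p + 2) < card ?W" using assms(3) d by auto
  have un: "card (X \<union> Y) \<le> 2 * p + 3" if "X \<in> \<F>" "Y \<in> \<F>" for X Y
  proof -
    have "2 * d + 1 = 2 * p + 3" using d by simp
    then show ?thesis using assms(5) that unfolding union_family_def by metis
  qed
  have fin: "finite X" if "X \<in> \<F>" for X using that assms(4) by (meson PowD finite_atLeastAtMost finite_subset subsetD)
  have f\<F>: "finite \<F>" using assms(4) by (meson finite_Pow_iff finite_atLeastAtMost finite_subset)
  define T where "T = {X \<in> \<F>. p + 3 \<le> card X}"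
  define G where "G = {X \<in> \<F>. card X = Suc (Suc p)}"
  have "card T \<le> (card ?W - 3) choose p"
    by (rule large_sets_le[OF W]) (use assms(4) un in \<open>auto simp: T_def\<close>)
  then have cT: "card T \<le> ?C" by simp
  have "cross 1 G G"
    unfolding cross_def
  proof (intro ballI)
    fix X Y assume "X \<in> G" "Y \<in> G"
    then have "X \<in> \<F>" "Y \<in> \<F>" "card X = Suc (Suc p)" "card Y = Suc (Suc p)" by (auto simp: G_def)
    \<comment> \<open>Two disjoint members of size \<open>p + 2\<close> would have a union of size
      \<open>2 * p + 4\<close>.\<close>
    then show "1 \<le> card (X \<inter> Y)" using card_Un_Int[of X Y] un[of X Y] fin by simp
  qed
  moreover have "G \<subseteq> ksets ?W (Suc (Suc p))" using assms(4) by (auto simp: G_def)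
  ultimately obtain x where x: "x \<in> ?W" "card {X \<in> G. x \<notin> X} \<le> ?C"
    using diversity_le[OF W, of G] by auto
  have "\<F> - kfam n d x \<subseteq> T \<union> {X \<in> G. x \<notin> X}"
  proof
    fix X assume X: "X \<in> \<F> - kfam n d x"
    then have "X \<subseteq> ?W" using assms(4) by auto
    then have gt: "Suc p < card (X - {x})" using X d by (auto simp: kfam_def)
    show "X \<in> T \<union> {X \<in> G. x \<notin> X}"
    proof (cases "x \<in> X")
      case True
      then have "card X = Suc (card (X - {x}))" using fin X by (metis DiffD1 card_Suc_Diff1)
      then show ?thesis using gt X by (simp add: T_def)
    next
      case False
      then show ?thesis using gt X by (auto simp: T_def G_def)
    qed
  qed
  then have "card (\<F> - kfam n d x) \<le> card T + card {X \<in> G. x \<notin> X}"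
    by (rule card_cover_le) (use f\<F> in \<open>simp_all add: T_def G_def\<close>)
  then have "card (\<F> - kfam n d x) \<le> 2 * ?C" using cT x(2) by linarith
  moreover have "overflow n d \<F> \<le> card (\<F> - kfam n d x)"
    unfolding overflow_def using x(1) by (intro Min_le) auto
  ultimately show ?thesis using d by simp
qed

end
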